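(* For every constant $\gamma > 0$, there exists a polynomial-time algorithm that, given a satisfiable projection game on a random bipartite graph $(A, B, E) \sim \mathcal{G}(n/2, n/2, p)$ for any $p \geq 10\sqrt{\log n / n}$, produces an assignment of value $\Omega(N^{-\gamma})$ for the instance with probability $1 - o(1)$.
   Context: A projection game $(q, A, B, E, \{\pi_e\}_{e\in E})$ consists of a simple bipartite graph $(A,B,E)$ and, for each edge $e=(a,b)\in E$ with $a\in A$, $b\in B$, a map $\pi_e:[q]\to[q]$, where $[q]=\{1,\dots,q\}$. An assignment is a map $\varphi:A\cup B\to[q]$; edge $e=(a,b)$ is satisfied if $\pi_e(\varphi(a))=\varphi(b)$. The value of an assignment is the fraction of edges it satisfies; the game is satisfiable if some assignment satisfies all edges. $n=|A|+|B|$ is the number of vertices and $N=nq$. $\mathcal{G}(n/2,n/2,p)$ is the random bipartite graph with $n/2$ vertices on each side in which each left-right pair is an edge independently with probability $p$. The probability is over the random graph. *)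

theory Defs
  imports "HOL-Probability.Product_PMF" "HOL-Computational_Algebra.Polynomial"
begin

section \<open>Model of computation\<close>

text \<open>
  Algorithms are programs of Jones's WHILE language over binary trees (N. D. Jones,
  Computability and Complexity from a Programming Perspective). Building a cell, taking a
  component and testing for an atom each cost one step. Since trees can be represented by
  pointers to shared cells, this measure is polynomially related to Turing machine time.
  There is deliberately no equality test on whole trees and no arithmetic.
\<close>

datatype data = Atom | Cell data data

fun left :: "data \<Rightarrow> data" where
  "left Atom = Atom"
| "left (Cell d e) = d"

fun right :: "data \<Rightarrow> data" where
  "right Atom = Atom"
| "right (Cell d e) = e"

type_synonym var = nat
type_synonym store = "var \<Rightarrow> data"

datatype expr = Var var | Const_Atom | Mk_Cell expr expr | Left expr | Right expr

fun val_of :: "expr \<Rightarrow> store \<Rightarrow> data" where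
  "val_of (Var x) s = s x"
| "val_of Const_Atom s = Atom"
| "val_of (Mk_Cell e f) s = Cell (val_of e s) (val_of f s)"
| "val_of (Left e) s = left (val_of e s)"
| "val_of (Right e) s = right (val_of e s)"

fun cost :: "expr \<Rightarrow> nat" where
  "cost (Var x) = 1"
| "cost Const_Atom = 1"
| "cost (Mk_Cell e f) = 1 + cost e + cost f"
| "cost (Left e) = 1 + cost e"
| "cost (Right e) = 1 + cost e"

datatype prog =
    Skip
  | Assign var expr
  | Seq prog prog
  | If expr prog prog
  | While expr prog

text \<open>\<open>exec c s t s'\<close>: started in \<open>s\<close>, program \<open>c\<close> halts in \<open>s'\<close> after exactly \<open>t\<close> steps.
  A test succeeds iff its value is not \<open>Atom\<close>.\<close>

inductive exec :: "prog \<Rightarrow> store \<Rightarrow> nat \<Rightarrow> store \<Rightarrow> bool" where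
  Skip: "exec Skip s 1 s"
| Assign: "exec (Assign x e) s (1 + cost e) (s(x := val_of e s))"
| Seq: "exec c s t s' \<Longrightarrow> exec d s' u s'' \<Longrightarrow> exec (Seq c d) s (t + u) s''"
| If_True: "val_of e s \<noteq> Atom \<Longrightarrow> exec c s t s' \<Longrightarrow> exec (If e c d) s (1 + cost e + t) s'"
| If_False: "val_of e s = Atom \<Longrightarrow> exec d s t s' \<Longrightarrow> exec (If e c d) s (1 + cost e + t) s'"
| While_False: "val_of e s = Atom \<Longrightarrow> exec (While e c) s (1 + cost e) s"
| While_True: "val_of e s \<noteq> Atom \<Longrightarrow> exec c s t s' \<Longrightarrow> exec (While e c) s' u s'' \<Longrightarrow>
    exec (While e c) s (1 + cost e + t + u) s''"

inductive_cases exec_SkipE: "exec Skip s t s'"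
inductive_cases exec_AssignE: "exec (Assign x e) s t s'"
inductive_cases exec_SeqE: "exec (Seq c d) s t s'"
inductive_cases exec_IfE: "exec (If e c d) s t s'"
inductive_cases exec_WhileE: "exec (While e c) s t s'"

lemma exec_deterministic:
  "exec c s t s' \<Longrightarrow> exec c s u s'' \<Longrightarrow> t = u \<and> s' = s''"
proof (induction arbitrary: u s'' rule: exec.induct)
  case Skip
  then show ?case by (auto elim: exec_SkipE)
next
  case Assign
  then show ?case by (auto elim: exec_AssignE)
next
  case Seq
  then show ?case by (elim exec_SeqE) metis
next
  case If_True
  from If_True.prems If_True.hyps(1) show ?case
    by (auto elim!: exec_IfE dest: If_True.IH)
next
  case If_False
  from If_False.prems If_False.hyps(1) show ?case
    by (auto elim!: exec_IfE dest: If_False.IH)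
next
  case While_False
  from While_False.prems show ?case
    by (cases rule: exec_WhileE) (use While_False.hyps in auto)
next
  case While_True
  from While_True.prems show ?case
    by (cases rule: exec_WhileE) (use While_True.hyps(1) in \<open>auto dest: While_True.IH\<close>)
qed

definition initial_store :: "data \<Rightarrow> store" where
  "initial_store d = (\<lambda>_. Atom)(0 := d)"

text \<open>Input and output are held in variable 0.\<close>

definition runs :: "prog \<Rightarrow> data \<Rightarrow> nat \<Rightarrow> data \<Rightarrow> bool" where
  "runs c d t r \<longleftrightarrow> (\<exists>s. exec c (initial_store d) t s \<and> s 0 = r)"

definition polynomial_time_on :: "prog \<Rightarrow> data set \<Rightarrow> bool" where
  "polynomial_time_on c I \<longleftrightarrow>
    (\<exists>P :: nat poly. \<forall>d\<in>I. \<exists>t r. runs c d t r \<and> t \<le> poly P (size d))"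


section \<open>Projection games\<close>

text \<open>
  The vertex sets are \<open>A = {..<left_count G}\<close> and \<open>B = {..<right_count G}\<close>. As these overlap as
  sets of numbers, an assignment is a function on their disjoint sum, where \<open>Inl a\<close> stands for
  the vertex \<open>a\<close> of \<open>A\<close> and \<open>Inr b\<close> for the vertex \<open>b\<close> of \<open>B\<close>. An edge is a pair \<open>(a, b)\<close>.
\<close>

record projection_game =
  left_count :: nat
  right_count :: nat
  labels :: nat
  edges :: "(nat \<times> nat) set"
  projection :: "nat \<times> nat \<Rightarrow> nat \<Rightarrow> nat"

definition valid_game :: "projection_game \<Rightarrow> bool" where
  "valid_game G \<longleftrightarrow>
    edges G \<subseteq> {..<left_count G} \<times> {..<right_count G} \<and>
    (\<forall>e\<in>edges G. projection G e ` {1..labels G} \<subseteq> {1..labels G})"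

definition is_assignment :: "projection_game \<Rightarrow> (nat + nat \<Rightarrow> nat) \<Rightarrow> bool" where
  "is_assignment G \<phi> \<longleftrightarrow>
    \<phi> ` ({..<left_count G} <+> {..<right_count G}) \<subseteq> {1..labels G}"

definition satisfies :: "projection_game \<Rightarrow> (nat + nat \<Rightarrow> nat) \<Rightarrow> nat \<times> nat \<Rightarrow> bool" where
  "satisfies G \<phi> e \<longleftrightarrow> projection G e (\<phi> (Inl (fst e))) = \<phi> (Inr (snd e))"

definition assignment_value :: "projection_game \<Rightarrow> (nat + nat \<Rightarrow> nat) \<Rightarrow> real" where
  "assignment_value G \<phi> = real (card {e \<in> edges G. satisfies G \<phi> e}) / real (card (edges G))"

definition satisfiable :: "projection_game \<Rightarrow> bool" where
  "satisfiable G \<longleftrightarrow> (\<exists>\<phi>. is_assignment G \<phi> \<and> (\<forall>e\<in>edges G. satisfies G \<phi> e))"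

definition vertex_count :: "projection_game \<Rightarrow> nat" where
  "vertex_count G = left_count G + right_count G"

definition game_size :: "projection_game \<Rightarrow> nat" where
  "game_size G = vertex_count G * labels G"


section \<open>Inputs and outputs of algorithms\<close>

text \<open>
  Numbers are written in unary, so that the size of the encoding of a game with at least one
  vertex and one label is polynomially related to \<open>game_size\<close>. A game is encoded by the sizes
  of its two sides and of its label set, followed by its matrix: the entry at \<open>(a, b)\<close> is
  \<open>Atom\<close> for a non-edge and otherwise a cell carrying the table of the edge's projection.
\<close>

fun encode_nat :: "nat \<Rightarrow> data" where
  "encode_nat 0 = Atom"
| "encode_nat (Suc n) = Cell Atom (encode_nat n)"

fun encode_list :: "('a \<Rightarrow> data) \<Rightarrow> 'a list \<Rightarrow> data" where
  "encode_list f [] = Atom"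
| "encode_list f (x # xs) = Cell (f x) (encode_list f xs)"

definition encode_entry :: "projection_game \<Rightarrow> nat \<times> nat \<Rightarrow> data" where
  "encode_entry G e =
    (if e \<in> edges G
     then Cell Atom (encode_list (\<lambda>x. encode_nat (projection G e x)) [1..<Suc (labels G)])
     else Atom)"

definition encode_game :: "projection_game \<Rightarrow> data" where
  "encode_game G =
    Cell (encode_nat (left_count G)) (Cell (encode_nat (right_count G)) (Cell (encode_nat (labels G))
      (encode_list (\<lambda>a. encode_list (\<lambda>b. encode_entry G (a, b)) [0..<right_count G])
        [0..<left_count G])))"

definition encode_assignment :: "projection_game \<Rightarrow> (nat + nat \<Rightarrow> nat) \<Rightarrow> data" where
  "encode_assignment G \<phi> =
    Cell (encode_list (\<lambda>a. encode_nat (\<phi> (Inl a))) [0..<left_count G])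
         (encode_list (\<lambda>b. encode_nat (\<phi> (Inr b))) [0..<right_count G])"

definition produces :: "prog \<Rightarrow> projection_game \<Rightarrow> (nat + nat \<Rightarrow> nat) \<Rightarrow> bool" where
  "produces c G \<phi> \<longleftrightarrow>
    is_assignment G \<phi> \<and> (\<exists>t. runs c (encode_game G) t (encode_assignment G \<phi>))"


section \<open>Random bipartite graphs\<close>

text \<open>The edge set of \<open>\<G>(k, l, p)\<close>; the second argument of \<open>Pi_pmf\<close> is the value
  outside of the finite index set, so pairs out of range are never edges.\<close>

definition random_bipartite :: "nat \<Rightarrow> nat \<Rightarrow> real \<Rightarrow> (nat \<times> nat) set pmf" where
  "random_bipartite k l p =
    map_pmf Collect (Pi_pmf ({..<k} \<times> {..<l}) False (\<lambda>_. bernoulli_pmf p))"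

end

theory Submission
  imports Defs
begin

text \<open>
  Fix a satisfying assignment, with labels \<open>\<sigma> a\<close> on the left and \<open>\<tau> b\<close> on the right, and \<open>m = n / 2\<close>.
  A partial labelling of \<open>B\<close> that agrees with \<open>\<tau>\<close> leaves for each \<open>a\<close> a set \<open>L a\<close> of consistent
  labels, which contains \<open>\<sigma> a\<close>. Drawing a label for each \<open>a\<close> uniformly from \<open>L a\<close> and labelling \<open>B\<close> by
  plurality achieves in expectation at least the average over the edges \<open>(a, b)\<close> of the fraction of \<open>L a\<close> that
  is projected to \<open>\<tau> b\<close>. If this average is below a small multiple of \<open>N powr -\<gamma>\<close>, then
  guessing the label \<open>\<sigma> a'\<close> of a suitable \<open>a'\<close>, and thereby the labels of all its neighbours, shrinks
  the geometric mean of the \<open>card (L a)\<close> by a factor \<open>N powr \<gamma>\<close>. Here one uses that with high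
  probability any two left vertices have at least \<open>p\<^sup>2 m / 4\<close> common neighbours and every right degree is at
  most \<open>3 p m\<close>. As \<open>1 \<le> card (L a) \<le> q < N\<close>, there are fewer than \<open>k = \<lceil>1 / \<gamma>\<rceil>\<close> such steps,
  so trying all sequences of at most \<open>k\<close> guesses succeeds.
\<close>

section \<open>Polynomial-time functions\<close>

text \<open>The useful guess is found by averaging over all \<open>a'\<close>. Each common neighbour
  \<open>b\<close> of \<open>a\<close> and \<open>a'\<close> bounds the factor by which the label
  set of \<open>a\<close> shrinks by the fraction of it projected to \<open>\<tau> b\<close>. Summed
  over all pairs, an edge \<open>(a, b)\<close> is charged once per neighbour of \<open>b\<close>.
  Hence lower bounds on codegrees and upper bounds on right degrees are all that is asked of the
  graph. As they do not mention the projections, the guarantee holds for all games on a good graph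
  at once. With codegrees at least \<open>K = p\<^sup>2 * m / 4\<close>, degrees at most
  \<open>D = 3 * p * m\<close> and thus at most \<open>m * D\<close> edges, the constants combine to
  1/72. The algorithm knows neither \<open>p\<close> nor the satisfying assignment: it rounds every
  candidate deterministically and keeps the best result. The machine has no arithmetic and no
  equality test on trees, so running times are derived from a class of functions with closure
  properties. Since shared cells permit exponentially large trees after few steps, that class has to
  control sizes as well as times.\<close>

class encodable =
  fixes enc :: "'a \<Rightarrow> data"

instantiation unit :: encodable
begin
definition "enc (u :: unit) = Atom"
instance ..
end

instantiation nat :: encodable
begin
definition "enc (n :: nat) = encode_nat n"
instance ..
end

instantiation bool :: encodable
begin
definition "enc b = (if b then Cell Atom Atom else Atom)"
instance ..
end

instantiation prod :: (encodable, encodable) encodable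
begin
definition "enc p = Cell (enc (fst p)) (enc (snd p))"
instance ..
end

instantiation list :: (encodable) encodable
begin
definition "enc xs = encode_list enc xs"
instance ..
end

text \<open>Agrees with the prescribed matrix entries: \<open>Atom\<close> for a non-edge, otherwise
  a cell whose right component is the table.\<close>

instantiation option :: (encodable) encodable
begin
definition "enc x = (case x of None \<Rightarrow> Atom | Some y \<Rightarrow> Cell Atom (enc y))"
instance ..
end

lemma enc_simps [simp]:
  "enc () = Atom"
  "enc (0 :: nat) = Atom"
  "enc (Suc n) = Cell Atom (enc n)"
  "enc False = Atom"
  "enc True = Cell Atom Atom"
  "enc (a, b) = Cell (enc a) (enc b)"
  "enc [] = Atom"
  "enc (x # xs) = Cell (enc x) (enc xs)"
  "enc None = Atom"
  "enc (Some y) = Cell Atom (enc y)"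
  by (simp_all add: enc_unit_def enc_nat_def enc_bool_def enc_prod_def enc_list_def enc_option_def)

text \<open>Unary numbers and lists of units coincide as trees, so a number can drive a loop over a
  list.\<close>

lemma enc_replicate_unit: "enc (replicate n ()) = enc n"
  by (induction n) auto

lemma right_enc_nat [simp]: "right (enc (n :: nat)) = enc (n - 1)"
  by (cases n) auto

lemma right_enc_list [simp]: "right (enc xs) = enc (tl xs)"
  by (cases xs) auto

lemma enc_list_eq_Atom [simp]: "enc xs = Atom \<longleftrightarrow> xs = []"
  by (cases xs) auto

lemma enc_nat_eq_Atom [simp]: "enc (n :: nat) = Atom \<longleftrightarrow> n = 0"
  by (cases n) auto

lemma enc_bool_eq_Atom [simp]: "enc b = Atom \<longleftrightarrow> \<not> b"
  by (cases b) auto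

definition esize :: "'a :: encodable \<Rightarrow> nat" where
  "esize x = size (enc x)"

lemma esize_simps [simp]:
  "esize () = 0"
  "esize (a, b) = Suc (esize a + esize b)"
  "esize [] = 0"
  "esize (x # xs) = Suc (esize x + esize xs)"
  "esize None = 0"
  "esize (Some y) = Suc (esize y)"
  by (simp_all add: esize_def)

lemma esize_nat [simp]: "esize (n :: nat) = n"
  by (induction n) (auto simp: esize_def)

lemma esize_fst_le: "esize (fst p) \<le> esize p"
  by (cases p) auto

lemma esize_snd_le: "esize (snd p) \<le> esize p"
  by (cases p) auto

lemma esize_append [simp]: "esize (xs @ ys) = esize xs + esize ys"
  by (induction xs) auto

lemma esize_rev [simp]: "esize (rev xs) = esize xs"
  by (induction xs) auto

lemma length_le_esize: "length xs \<le> esize xs"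
  by (induction xs) auto

lemma esize_member: "x \<in> set xs \<Longrightarrow> esize x \<le> esize xs"
  by (induction xs) auto

lemma esize_list_le:
  assumes "\<And>x. x \<in> set xs \<Longrightarrow> esize x \<le> b"
  shows "esize xs \<le> length xs * (b + 1)"
  using assms by (induction xs) (simp, fastforce)

subsection \<open>Polynomially bounded functions\<close>

text \<open>The base is at least 2, so powers grow with the exponent and absorb every constant
  \<open>c\<close> through \<open>c \<le> 2 ^ c\<close>; a single exponent then describes the
  bound.\<close>

definition poly_bounded :: "('a :: encodable \<Rightarrow> nat) \<Rightarrow> bool" where
  "poly_bounded f \<longleftrightarrow> (\<exists>k. \<forall>x. f x \<le> (esize x + 2) ^ k)"

named_theorems poly_bounded_intros

lemma poly_boundedI: "(\<And>x. f x \<le> (esize x + 2) ^ k) \<Longrightarrow> poly_bounded f"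
  by (auto simp: poly_bounded_def)

lemma poly_bounded_mono: "poly_bounded g \<Longrightarrow> (\<And>x. f x \<le> g x) \<Longrightarrow> poly_bounded f"
  unfolding poly_bounded_def using le_trans by blast

lemma poly_bounded_const [poly_bounded_intros]: "poly_bounded (\<lambda>_. c)"
proof (rule poly_boundedI)
  fix x :: 'a
  have "c \<le> 2 ^ c"
    by (simp add: less_imp_le)
  also have "\<dots> \<le> (esize x + 2) ^ c"
    by (rule power_mono) auto
  finally show "c \<le> (esize x + 2) ^ c" .
qed

lemma poly_bounded_esize [poly_bounded_intros]: "poly_bounded esize"
  by (rule poly_boundedI[of _ 1]) auto

lemma poly_bounded_mult [poly_bounded_intros]:
  assumes "poly_bounded f" "poly_bounded g"
  shows "poly_bounded (\<lambda>x. f x * g x)"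
proof -
  from assms(1) obtain k where "\<And>x. f x \<le> (esize x + 2) ^ k"
    unfolding poly_bounded_def by blast
  moreover from assms(2) obtain l where "\<And>x. g x \<le> (esize x + 2) ^ l"
    unfolding poly_bounded_def by blast
  ultimately show ?thesis
    by (intro poly_boundedI[of _ "k + l"]) (simp add: power_add mult_le_mono)
qed

lemma poly_bounded_power [poly_bounded_intros]:
  "poly_bounded f \<Longrightarrow> poly_bounded (\<lambda>x. f x ^ k)"
  by (induction k) (auto intro: poly_bounded_intros)

lemma poly_bounded_add [poly_bounded_intros]:
  assumes "poly_bounded f" "poly_bounded g"
  shows "poly_bounded (\<lambda>x. f x + g x)"
proof -
  \<comment> \<open>A sum is at most the product of the successors of its terms, and a successor
    costs one more factor of the base.\<close>
  have "poly_bounded (\<lambda>x. (f x * 1 + 1) * (g x * 1 + 1))" if "poly_bounded (\<lambda>x. f x * 1 + 1)"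
      "poly_bounded (\<lambda>x. g x * 1 + 1)"
    using that by (rule poly_bounded_mult)
  moreover have "poly_bounded (\<lambda>x. h x * 1 + 1)" if "poly_bounded h" for h :: "'a \<Rightarrow> nat"
  proof -
    from that obtain k where k: "\<And>x. h x \<le> (esize x + 2) ^ k"
      unfolding poly_bounded_def by blast
    show ?thesis
    proof (rule poly_boundedI)
      fix x
      have "h x * 1 + 1 \<le> (esize x + 2) ^ k + (esize x + 2) ^ k"
        using k[of x] by (intro add_mono) auto
      also have "\<dots> = 2 * (esize x + 2) ^ k"
        by simp
      also have "\<dots> \<le> (esize x + 2) * (esize x + 2) ^ k"
        by (intro mult_right_mono) auto
      finally show "h x * 1 + 1 \<le> (esize x + 2) ^ Suc k"
        by simp
    qed
  qed
  ultimately have "poly_bounded (\<lambda>x. (f x * 1 + 1) * (g x * 1 + 1))"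
    using assms by blast
  then show ?thesis
    by (rule poly_bounded_mono) (simp add: algebra_simps)
qed

lemma poly_bounded_Suc [poly_bounded_intros]: "poly_bounded f \<Longrightarrow> poly_bounded (\<lambda>x. Suc (f x))"
  using poly_bounded_add[of f "\<lambda>_. 1"] by (simp add: poly_bounded_const)

lemma poly_bounded_comp:
  assumes "poly_bounded f" "poly_bounded (\<lambda>x. esize (h x))"
  shows "poly_bounded (\<lambda>x. f (h x))"
proof -
  from assms(1) obtain k where "\<And>x. f x \<le> (esize x + 2) ^ k"
    unfolding poly_bounded_def by blast
  then show ?thesis
    by (rule poly_bounded_mono[rotated]) (intro poly_bounded_intros assms)
qed

subsection \<open>Functions computable in polynomial time\<close>

text \<open>
  The computing program may be started in a store with arbitrary contents outside of variable 0
  and must leave all variables from some index on unchanged. This makes it usable as a subroutine.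
\<close>

definition computes :: "prog \<Rightarrow> nat \<Rightarrow> ('a \<Rightarrow> nat) \<Rightarrow> ('a :: encodable \<Rightarrow> 'b :: encodable) \<Rightarrow> bool" where
  "computes c v T f \<longleftrightarrow> 0 < v \<and> (\<forall>s x. s 0 = enc x \<longrightarrow>
     (\<exists>t s'. exec c s t s' \<and> s' 0 = enc (f x) \<and> (\<forall>y\<ge>v. s' y = s y) \<and> t \<le> T x))"

text \<open>The size condition does not follow from the time bound: repeatedly pairing a tree with
  itself makes it exponentially large. Composition relies on it, because the second program is timed
  by the size of its own input.\<close>

definition ptime :: "('a :: encodable \<Rightarrow> 'b :: encodable) \<Rightarrow> bool" where
  "ptime f \<longleftrightarrow> poly_bounded (\<lambda>x. esize (f x)) \<and> (\<exists>c v T. poly_bounded T \<and> computes c v T f)"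

named_theorems ptime_intros

lemma ptimeE:
  assumes "ptime f"
  obtains c v T where "poly_bounded T" "computes c v T f"
  using assms by (auto simp: ptime_def)

lemma ptime_imp_poly_bounded: "ptime f \<Longrightarrow> poly_bounded (\<lambda>x. esize (f x))"
  by (simp add: ptime_def)

lemma computesD:
  "computes c v T f \<Longrightarrow> s 0 = enc x \<Longrightarrow>
    \<exists>t s'. exec c s t s' \<and> s' 0 = enc (f x) \<and> (\<forall>y\<ge>v. s' y = s y) \<and> t \<le> T x"
  unfolding computes_def by blast

lemma ptimeI:
  assumes "poly_bounded (\<lambda>x. esize (f x))" "poly_bounded T" "0 < v"
    "\<And>s x. s 0 = enc x \<Longrightarrow>
      \<exists>t s'. exec c s t s' \<and> s' 0 = enc (f x) \<and> (\<forall>y\<ge>v. s' y = s y) \<and> t \<le> T x"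
  shows "ptime f"
  using assms unfolding ptime_def computes_def by blast

lemma exec_Assign': "s' = s(x := val_of e s) \<Longrightarrow> t = 1 + cost e \<Longrightarrow> exec (Assign x e) s t s'"
  using exec.Assign by simp

lemma ptime_expr:
  fixes f :: "'a :: encodable \<Rightarrow> 'b :: encodable"
  assumes "poly_bounded (\<lambda>x. esize (f x))" "\<And>s x. s 0 = enc x \<Longrightarrow> val_of e s = enc (f x)"
  shows "ptime f"
proof (rule ptimeI[where c = "Assign 0 e" and v = 1 and T = "\<lambda>_. 1 + cost e"])
  fix s :: store and x :: 'a
  assume "s 0 = enc x"
  then show "\<exists>t s'. exec (Assign 0 e) s t s' \<and> s' 0 = enc (f x) \<and> (\<forall>y\<ge>1. s' y = s y) \<and> t \<le> 1 + cost e"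
    using assms(2) exec.Assign[of 0 e s] by (intro exI[of _ "1 + cost e"] exI[of _ "s(0 := val_of e s)"]) auto
qed (use assms in \<open>auto intro: poly_bounded_const\<close>)

lemma ptime_ident [ptime_intros]: "ptime (\<lambda>x. x)"
  by (rule ptime_expr[of _ "Var 0"]) (auto intro: poly_bounded_intros)

primrec data_expr :: "data \<Rightarrow> expr" where
  "data_expr Atom = Const_Atom"
| "data_expr (Cell d e) = Mk_Cell (data_expr d) (data_expr e)"

lemma val_of_data_expr [simp]: "val_of (data_expr d) s = d"
  by (induction d) auto

lemma ptime_const [ptime_intros]: "ptime (\<lambda>_. c)"
  by (rule ptime_expr[of _ "data_expr (enc c)"]) (auto intro: poly_bounded_intros)

lemma ptime_comp:
  fixes g :: "'a :: encodable \<Rightarrow> 'b :: encodable" and f :: "'b \<Rightarrow> 'c :: encodable"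
  assumes "ptime f" "ptime g"
  shows "ptime (\<lambda>x. f (g x))"
proof -
  from assms(1) obtain c v T where c: "poly_bounded T" "computes c v T f"
    by (rule ptimeE)
  from assms(2) obtain d w U where d: "poly_bounded U" "computes d w U g"
    by (rule ptimeE)
  show ?thesis
  proof (rule ptimeI[where c = "Seq d c" and v = "max v w" and T = "\<lambda>x. U x + T (g x)"])
    show "0 < max v w"
      using c(2) by (auto simp: computes_def)
    fix s :: store and x :: 'a
    assume "s 0 = enc x"
    from computesD[OF d(2), of s x, OF this] obtain t s1 where 1: "exec d s t s1" "s1 0 = enc (g x)" "\<And>y. y \<ge> w \<Longrightarrow> s1 y = s y" "t \<le> U x"
      by auto
    from computesD[OF c(2), of s1 "g x", OF this(2)] obtain u s2 where 2: "exec c s1 u s2" "s2 0 = enc (f (g x))" "\<And>y. y \<ge> v \<Longrightarrow> s2 y = s1 y"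
      "u \<le> T (g x)"
      by auto
    show "\<exists>t s'. exec (Seq d c) s t s' \<and> s' 0 = enc (f (g x)) \<and> (\<forall>y\<ge>max v w. s' y = s y) \<and>
        t \<le> U x + T (g x)"
      using 1 2 by (intro exI[of _ "t + u"] exI[of _ s2]) (auto intro: exec.Seq)
  next
    show "poly_bounded (\<lambda>x. U x + T (g x))"
      by (intro poly_bounded_add d poly_bounded_comp[OF c(1)] assms(2)[THEN ptime_imp_poly_bounded])
    show "poly_bounded (\<lambda>x. esize (f (g x)))"
      by (intro poly_bounded_comp[OF assms(1)[THEN ptime_imp_poly_bounded]] assms(2)[THEN ptime_imp_poly_bounded])
  qed
qed

lemma ptime_pair [ptime_intros]:
  fixes f :: "'a :: encodable \<Rightarrow> 'b :: encodable" and g :: "'a \<Rightarrow> 'c :: encodable"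
  assumes "ptime f" "ptime g"
  shows "ptime (\<lambda>x. (f x, g x))"
proof -
  from assms(1) obtain c v T where c: "poly_bounded T" "computes c v T f"
    by (rule ptimeE)
  from assms(2) obtain d w U where d: "poly_bounded U" "computes d w U g"
    by (rule ptimeE)
  define V where "V = max v w"
  have V: "V \<ge> v" "V \<ge> w" "0 < V"
    using c(2) by (auto simp: V_def computes_def)
  \<comment> \<open>\<open>V\<close> and \<open>V + 1\<close> lie beyond everything that
    \<open>c\<close> and \<open>d\<close> may change; they keep the input and the first
    result.\<close>
  define prog where "prog =
    Seq (Assign V (Var 0)) (Seq c (Seq (Assign (V + 1) (Var 0)) (Seq (Assign 0 (Var V)) (Seq d
      (Assign 0 (Mk_Cell (Var (V + 1)) (Var 0)))))))"
  show ?thesis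
  proof (rule ptimeI[where c = prog and v = "V + 2" and T = "\<lambda>x. T x + U x + 10"])
    fix s :: store and x :: 'a
    assume s0: "s 0 = enc x"
    define s1 where "s1 = s(V := s 0)"
    have "s1 0 = enc x"
      using s0 by (simp add: s1_def)
    from computesD[OF c(2), of s1 x, OF this] obtain t s2 where 2: "exec c s1 t s2" "s2 0 = enc (f x)" "\<And>y. y \<ge> v \<Longrightarrow> s2 y = s1 y" "t \<le> T x"
      by auto
    define s3 where "s3 = s2(V + 1 := s2 0)"
    define s4 where "s4 = s3(0 := s3 V)"
    have "s4 0 = enc x"
      using s0 V by (simp add: s4_def s3_def 2 s1_def)
    from computesD[OF d(2), of s4 x, OF this] obtain u s5 where 5: "exec d s4 u s5" "s5 0 = enc (g x)" "\<And>y. y \<ge> w \<Longrightarrow> s5 y = s4 y" "u \<le> U x"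
      by auto
    define s6 where "s6 = s5(0 := Cell (s5 (V + 1)) (s5 0))"
    have assigns: "exec (Assign V (Var 0)) s 2 s1" "exec (Assign (V + 1) (Var 0)) s2 2 s3"
      "exec (Assign 0 (Var V)) s3 2 s4" "exec (Assign 0 (Mk_Cell (Var (V + 1)) (Var 0))) s5 4 s6"
      by (auto intro!: exec_Assign' simp: s1_def s3_def s4_def s6_def)
    have "exec prog s (2 + (t + (2 + (2 + (u + 4))))) s6"
      unfolding prog_def
      by (rule exec.Seq[OF assigns(1) exec.Seq[OF 2(1) exec.Seq[OF assigns(2) exec.Seq[OF assigns(3)
            exec.Seq[OF 5(1) assigns(4)]]]]])
    moreover have "s6 0 = enc (f x, g x)"
      using V by (simp add: s6_def 5 s4_def s3_def 2)
    moreover have "\<forall>y\<ge>V + 2. s6 y = s y"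
      using V by (simp add: s6_def 5 s4_def s3_def 2 s1_def)
    ultimately show "\<exists>t s'. exec prog s t s' \<and> s' 0 = enc (f x, g x) \<and> (\<forall>y\<ge>V + 2. s' y = s y) \<and>
        t \<le> T x + U x + 10"
      using 2(4) 5(4) by (intro exI[of _ "2 + (t + (2 + (2 + (u + 4))))"] exI[of _ s6]) auto
  qed (auto intro!: poly_bounded_intros c d assms[THEN ptime_imp_poly_bounded])
qed

lemma ptime_comp2:
  assumes "ptime (\<lambda>p. h (fst p) (snd p))" "ptime f" "ptime g"
  shows "ptime (\<lambda>x. h (f x) (g x))"
  using ptime_comp[OF assms(1) ptime_pair[OF assms(2,3)]] by simp

text \<open>Common core of all case distinctions: a test, then a rearrangement of the input into the
  argument of the chosen branch. As this argument is no larger than the input, the bounds of the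
  branches carry over.\<close>

lemma ptime_dispatch:
  fixes h :: "'c :: encodable \<Rightarrow> 'd :: encodable"
  assumes "ptime f" "ptime g"
    and "\<And>s x. s 0 = enc x \<Longrightarrow> val_of b s \<noteq> Atom \<Longrightarrow>
      \<exists>y. val_of e s = enc y \<and> h x = f y \<and> esize y \<le> esize x"
    and "\<And>s x. s 0 = enc x \<Longrightarrow> val_of b s = Atom \<Longrightarrow>
      \<exists>y. val_of e' s = enc y \<and> h x = g y \<and> esize y \<le> esize x"
  shows "ptime h"
proof -
  from assms(1) obtain c v T where c: "poly_bounded T" "computes c v T f"
    by (rule ptimeE)
  from assms(2) obtain d w U where d: "poly_bounded U" "computes d w U g"
    by (rule ptimeE)
  from c(1) obtain k where k: "\<And>x. T x \<le> (esize x + 2) ^ k"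
    unfolding poly_bounded_def by blast
  from d(1) obtain l where l: "\<And>x. U x \<le> (esize x + 2) ^ l"
    unfolding poly_bounded_def by blast
  from assms(1)[THEN ptime_imp_poly_bounded] obtain i where i: "\<And>x. esize (f x) \<le> (esize x + 2) ^ i"
    unfolding poly_bounded_def by blast
  from assms(2)[THEN ptime_imp_poly_bounded] obtain j where j: "\<And>x. esize (g x) \<le> (esize x + 2) ^ j"
    unfolding poly_bounded_def by blast
  let ?T = "\<lambda>x :: 'c. (esize x + 2) ^ k + (esize x + 2) ^ l + (cost b + cost e + cost e' + 2)"
  have mono: "(a + 2) ^ n \<le> (a' + 2) ^ n" if "a \<le> a'" for a a' n :: nat
    using that by (intro power_mono) auto
  show ?thesis
  proof (rule ptimeI[where c = "If b (Seq (Assign 0 e) c) (Seq (Assign 0 e') d)" and v = "max v w" and T = ?T])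
    have "esize (h x) \<le> (esize x + 2) ^ i + (esize x + 2) ^ j" for x
    proof -
      \<comment> \<open>The argument \<open>y\<close> is only described through values of
        expressions, so some store holding \<open>x\<close> is needed even to bound the output
        size.\<close>
      obtain s :: store where s: "s 0 = enc x"
        by (metis fun_upd_same)
      show ?thesis
      proof (cases "val_of b s = Atom")
        case True
        with assms(4)[of s x] s obtain y where y: "h x = g y" "esize y \<le> esize x"
          by blast
        with j[of y] mono[OF y(2), of j] show ?thesis
          by (simp add: y)
      next
        case False
        with assms(3)[of s x] s obtain y where y: "h x = f y" "esize y \<le> esize x"
          by blast
        with i[of y] mono[OF y(2), of i] show ?thesis
          by (simp add: y)
      qed
    qed
    then show "poly_bounded (\<lambda>x. esize (h x))"
      by (rule poly_bounded_mono[rotated]) (intro poly_bounded_intros)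
    show "poly_bounded ?T"
      by (intro poly_bounded_intros)
    show "0 < max v w"
      using c(2) by (auto simp: computes_def)
    fix s :: store and x :: 'c
    assume s: "s 0 = enc x"
    show "\<exists>t s'. exec (If b (Seq (Assign 0 e) c) (Seq (Assign 0 e') d)) s t s' \<and> s' 0 = enc (h x) \<and>
      (\<forall>y\<ge>max v w. s' y = s y) \<and> t \<le> ?T x"
    proof (cases "val_of b s = Atom")
      case True
      with assms(4)[of s x] s obtain y where y: "val_of e' s = enc y" "h x = g y" "esize y \<le> esize x"
        by blast
      from computesD[OF d(2), of "s(0 := val_of e' s)" y] y obtain t s' where s': "exec d (s(0 := val_of e' s)) t s'" "s' 0 = enc (g y)"
        "\<And>z. z \<ge> w \<Longrightarrow> s' z = (s(0 := val_of e' s)) z" "t \<le> U y"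
        by auto
      have "w > 0"
        using d(2) by (auto simp: computes_def)
      moreover have "exec (If b (Seq (Assign 0 e) c) (Seq (Assign 0 e') d)) s (1 + cost b + ((1 + cost e') + t)) s'"
        by (rule exec.If_False[OF True exec.Seq[OF exec.Assign s'(1)]])
      ultimately show ?thesis
        using s' y l[of y] mono[OF y(3), of l]
        by (intro exI[of _ "1 + cost b + ((1 + cost e') + t)"] exI[of _ s']) auto
    next
      case False
      with assms(3)[of s x] s obtain y where y: "val_of e s = enc y" "h x = f y" "esize y \<le> esize x"
        by blast
      from computesD[OF c(2), of "s(0 := val_of e s)" y] y obtain t s' where s': "exec c (s(0 := val_of e s)) t s'" "s' 0 = enc (f y)"
        "\<And>z. z \<ge> v \<Longrightarrow> s' z = (s(0 := val_of e s)) z" "t \<le> T y"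
        by auto
      have "v > 0"
        using c(2) by (auto simp: computes_def)
      moreover have "exec (If b (Seq (Assign 0 e) c) (Seq (Assign 0 e') d)) s (1 + cost b + ((1 + cost e) + t)) s'"
        by (rule exec.If_True[OF False exec.Seq[OF exec.Assign s'(1)]])
      ultimately show ?thesis
        using s' y k[of y] mono[OF y(3), of k]
        by (intro exI[of _ "1 + cost b + ((1 + cost e) + t)"] exI[of _ s']) auto
    qed
  qed
qed

text \<open>The only place where a loop is programmed. Iterating a polynomial-time step may blow up
  the accumulator exponentially, so a bound \<open>B\<close> on all intermediate accumulators has to
  be supplied.\<close>

lemma ptime_fold:
  fixes g :: "'a :: encodable \<Rightarrow> 'b :: encodable \<Rightarrow> 'c :: encodable \<Rightarrow> 'c"
  assumes "ptime (\<lambda>p. g (fst p) (fst (snd p)) (snd (snd p)))" "ptime xs" "ptime init"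
    and "poly_bounded B"
    and bound: "\<And>x ys zs. xs x = ys @ zs \<Longrightarrow> esize (fold (g x) ys (init x)) \<le> B x"
  shows "ptime (\<lambda>x. fold (g x) (xs x) (init x))"
proof -
  let ?g = "\<lambda>p. g (fst p) (fst (snd p)) (snd (snd p))"
  have "ptime (\<lambda>x. (x, xs x, init x))"
    using assms(2,3) by (intro ptime_pair ptime_ident)
  then obtain c v T where c: "poly_bounded T" "computes c v T (\<lambda>x. (x, xs x, init x))"
    by (rule ptimeE)
  from assms(1) obtain d w U where d: "poly_bounded U" "computes d w U ?g"
    by (rule ptimeE)
  from d(1) obtain k where k: "\<And>p. U p \<le> (esize p + 2) ^ k"
    unfolding poly_bounded_def by blast
  define V where "V = max v w"
  have V: "V \<ge> v" "V \<ge> w" "0 < V"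
    using c(2) by (auto simp: V_def computes_def)
  \<comment> \<open>\<open>V\<close> holds \<open>x\<close>, \<open>V + 1\<close> the remaining list
    and \<open>V + 2\<close> the accumulator.\<close>
  define body where "body = Seq (Assign 0 (Mk_Cell (Var V) (Mk_Cell (Left (Var (V + 1))) (Var (V + 2)))))
    (Seq d (Seq (Assign (V + 2) (Var 0)) (Assign (V + 1) (Right (Var (V + 1))))))"
  define loop where "loop = While (Var (V + 1)) body"
  define prog where "prog = Seq c (Seq (Assign V (Left (Var 0))) (Seq (Assign (V + 1) (Left (Right (Var 0))))
    (Seq (Assign (V + 2) (Right (Right (Var 0)))) (Seq loop (Assign 0 (Var (V + 2)))))))"
  \<comment> \<open>A round costs 14 steps besides \<open>d\<close>: 2 for the test and 7, 2 and 3
    for the assignments. The last test costs 2. The bound \<open>\<tau>\<close> is demanded only at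
    accumulators that actually occur, where \<open>B\<close> applies.\<close>
  have loop: "\<exists>t s'. exec loop s t s' \<and> s' (V + 2) = enc (fold (g x) ys z) \<and>
      (\<forall>y\<ge>V + 3. s' y = s y) \<and> t \<le> 2 + length ys * (\<tau> + 14)"
    if "s V = enc x" "s (V + 1) = enc ys" "s (V + 2) = enc z"
      "\<And>us y vs. ys = us @ y # vs \<Longrightarrow> U (x, y, fold (g x) us z) \<le> \<tau>"
    for s x ys z \<tau>
    using that
  proof (induction ys arbitrary: s z)
    case Nil
    have "exec loop s (1 + cost (Var (V + 1))) s"
      unfolding loop_def by (rule exec.While_False) (use Nil.prems(2) in simp)
    then show ?case
      using Nil.prems(1-3) by (intro exI[of _ "1 + cost (Var (V + 1))"] exI[of _ s]) auto
  next
    case (Cons y ys)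
    define s1 where "s1 = s(0 := Cell (s V) (Cell (left (s (V + 1))) (s (V + 2))))"
    have "s1 0 = enc (x, y, z)"
      using Cons.prems(1-3) by (simp add: s1_def)
    from computesD[OF d(2), of s1 "(x, y, z)", OF this] obtain t s2 where 2: "exec d s1 t s2" "s2 0 = enc (g x y z)" "\<And>i. i \<ge> w \<Longrightarrow> s2 i = s1 i"
      "t \<le> U (x, y, z)"
      by auto
    define s3 where "s3 = s2(V + 2 := s2 0)"
    define s4 where "s4 = s3(V + 1 := right (s3 (V + 1)))"
    have assigns: "exec (Assign 0 (Mk_Cell (Var V) (Mk_Cell (Left (Var (V + 1))) (Var (V + 2))))) s 7 s1"
        "exec (Assign (V + 2) (Var 0)) s2 2 s3" "exec (Assign (V + 1) (Right (Var (V + 1)))) s3 3 s4"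
      by (auto intro!: exec_Assign' simp: s1_def s3_def s4_def)
    have body: "exec body s (7 + (t + (2 + 3))) s4"
      unfolding body_def
      by (rule exec.Seq[OF assigns(1) exec.Seq[OF 2(1) exec.Seq[OF assigns(2,3)]]])
    have s4: "s4 V = enc x" "s4 (V + 1) = enc ys" "s4 (V + 2) = enc (g x y z)"
      using V Cons.prems(1-3) by (simp_all add: s4_def s3_def 2 s1_def)
    have step: "U (x, y', fold (g x) us (g x y z)) \<le> \<tau>" if "ys = us @ y' # vs" for us y' vs
      using Cons.prems(4)[of "y # us" y' vs] that by simp
    have "\<exists>t s'. exec loop s4 t s' \<and> s' (V + 2) = enc (fold (g x) ys (g x y z)) \<and>
        (\<forall>y\<ge>V + 3. s' y = s4 y) \<and> t \<le> 2 + length ys * (\<tau> + 14)"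
      by (rule Cons.IH[OF s4]) (rule step)
    then obtain u s5 where 5: "exec loop s4 u s5" "s5 (V + 2) = enc (fold (g x) ys (g x y z))"
      "\<And>i. i \<ge> V + 3 \<Longrightarrow> s5 i = s4 i" "u \<le> 2 + length ys * (\<tau> + 14)"
      by auto
    have "exec loop s (1 + cost (Var (V + 1)) + (7 + (t + (2 + 3))) + u) s5"
      unfolding loop_def using Cons.prems(2) 5(1)[unfolded loop_def] by (intro exec.While_True[OF _ body]) auto
    moreover have "t \<le> \<tau>"
      using 2(4) Cons.prems(4)[of "[]" y ys] by simp
    moreover have "\<forall>i\<ge>V + 3. s5 i = s i"
      using V by (simp add: 5 s4_def s3_def 2 s1_def)
    ultimately show ?case
      using 5 by (intro exI[of _ "1 + cost (Var (V + 1)) + (7 + (t + (2 + 3))) + u"] exI[of _ s5]) auto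
  qed
  let ?\<tau> = "\<lambda>x. (esize x + esize (xs x) + B x + 4) ^ k"
  let ?T = "\<lambda>x. T x + esize (xs x) * (?\<tau> x + 14) + 20"
  show ?thesis
  proof (rule ptimeI[where c = prog and v = "V + 3" and T = ?T])
    show "poly_bounded (\<lambda>x. esize (fold (g x) (xs x) (init x)))"
      using bound[of _ _ "[]"] by (rule poly_bounded_mono[OF assms(4)]) simp
    show "poly_bounded ?T"
      by (intro poly_bounded_intros c assms(2)[THEN ptime_imp_poly_bounded] assms(4))
    fix s :: store and x :: 'a
    assume "s 0 = enc x"
    from computesD[OF c(2), of s x, OF this] obtain t s1 where 1: "exec c s t s1" "s1 0 = enc (x, xs x, init x)"
      "\<And>i. i \<ge> v \<Longrightarrow> s1 i = s i" "t \<le> T x"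
      by auto
    define s2 where "s2 = s1(V := enc x, V + 1 := enc (xs x), V + 2 := enc (init x))"
    have step: "U (x, y, fold (g x) us (init x)) \<le> ?\<tau> x" if "xs x = us @ y # vs" for us y vs
    proof -
      have "esize y \<le> esize (xs x)"
        by (intro esize_member) (simp add: that)
      moreover have "esize (fold (g x) us (init x)) \<le> B x"
        by (rule bound) (rule that)
      ultimately have "(esize (x, y, fold (g x) us (init x)) + 2) ^ k \<le> ?\<tau> x"
        by (intro power_mono) auto
      then show ?thesis
        using k order_trans by blast
    qed
    have "\<exists>t s'. exec loop s2 t s' \<and> s' (V + 2) = enc (fold (g x) (xs x) (init x)) \<and>
        (\<forall>y\<ge>V + 3. s' y = s2 y) \<and> t \<le> 2 + length (xs x) * (?\<tau> x + 14)"
      by (rule loop) (rule step | simp add: s2_def)+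
    then obtain u s3 where 3: "exec loop s2 u s3"
        "s3 (V + 2) = enc (fold (g x) (xs x) (init x))" "\<And>i. i \<ge> V + 3 \<Longrightarrow> s3 i = s2 i"
        "u \<le> 2 + length (xs x) * (?\<tau> x + 14)"
      by auto
    have assigns: "exec (Assign V (Left (Var 0))) s1 3 (s1(V := enc x))"
        "exec (Assign (V + 1) (Left (Right (Var 0)))) (s1(V := enc x)) 4 (s1(V := enc x, V + 1 := enc (xs x)))"
        "exec (Assign (V + 2) (Right (Right (Var 0)))) (s1(V := enc x, V + 1 := enc (xs x))) 4 s2"
        "exec (Assign 0 (Var (V + 2))) s3 2 (s3(0 := s3 (V + 2)))"
      using V 1(2) by (auto intro!: exec_Assign' simp: s2_def)
    have "exec prog s (t + (3 + (4 + (4 + (u + 2))))) (s3(0 := s3 (V + 2)))"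
      unfolding prog_def
      by (rule exec.Seq[OF 1(1) exec.Seq[OF assigns(1) exec.Seq[OF assigns(2) exec.Seq[OF assigns(3)
            exec.Seq[OF 3(1) assigns(4)]]]]])
    moreover have "length (xs x) * (?\<tau> x + 14) \<le> esize (xs x) * (?\<tau> x + 14)"
      by (intro mult_right_mono length_le_esize) auto
    moreover have "\<forall>i\<ge>V + 3. (s3(0 := s3 (V + 2))) i = s i"
      using V by (simp add: 3 s2_def 1)
    moreover from calculation(2) 1(4) 3(4) have "t + (3 + (4 + (4 + (u + 2)))) \<le> ?T x"
      by linarith
    ultimately show "\<exists>t s'. exec prog s t s' \<and> s' 0 = enc (fold (g x) (xs x) (init x)) \<and>
        (\<forall>y\<ge>V + 3. s' y = s y) \<and> t \<le> ?T x"
      using 3(2)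
      by (intro exI[of _ "t + (3 + (4 + (4 + (u + 2))))"] exI[of _ "s3(0 := s3 (V + 2))"]) auto
  qed simp
qed

subsection \<open>Closure properties\<close>

lemma ptime_fst [ptime_intros]: "ptime f \<Longrightarrow> ptime (\<lambda>x. fst (f x))"
  by (rule ptime_comp, rule ptime_expr[of _ "Left (Var 0)"])
    (auto simp: enc_prod_def intro: poly_bounded_mono[OF poly_bounded_esize] esize_fst_le)

lemma ptime_snd [ptime_intros]: "ptime f \<Longrightarrow> ptime (\<lambda>x. snd (f x))"
  by (rule ptime_comp, rule ptime_expr[of _ "Right (Var 0)"])
    (auto simp: enc_prod_def intro: poly_bounded_mono[OF poly_bounded_esize] esize_snd_le)

lemma ptime_Suc [ptime_intros]: "ptime f \<Longrightarrow> ptime (\<lambda>x. Suc (f x))"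
  by (rule ptime_comp, rule ptime_expr[of _ "Mk_Cell Const_Atom (Var 0)"])
    (auto intro!: poly_bounded_mono[OF poly_bounded_Suc[OF poly_bounded_esize]])

lemma ptime_pred: "ptime f \<Longrightarrow> ptime (\<lambda>x. f x - Suc 0)"
  by (rule ptime_comp, rule ptime_expr[of _ "Right (Var 0)"])
    (auto intro!: poly_bounded_mono[OF poly_bounded_esize])

lemma esize_tl_le: "esize (tl xs) \<le> esize xs"
  by (cases xs) auto

lemma ptime_tl [ptime_intros]: "ptime f \<Longrightarrow> ptime (\<lambda>x. tl (f x))"
  by (rule ptime_comp, rule ptime_expr[of _ "Right (Var 0)"])
    (auto intro!: poly_bounded_mono[OF poly_bounded_esize] esize_tl_le)

lemma ptime_Cons [ptime_intros]:
  assumes "ptime f" "ptime g"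
  shows "ptime (\<lambda>x. f x # g x)"
proof (rule ptime_comp2[where h = Cons, OF _ assms])
  \<comment> \<open>A pair and a nonempty list have the same encoding, so the program merely copies
    its input.\<close>
  show "ptime (\<lambda>p :: 'b \<times> 'b list. fst p # snd p)"
    by (rule ptime_expr[of _ "Var 0"])
      (auto simp: enc_prod_def intro!: poly_bounded_mono[OF poly_bounded_Suc[OF poly_bounded_esize]])
qed

lemma ptime_if [ptime_intros]:
  assumes "ptime b" "ptime f" "ptime g"
  shows "ptime (\<lambda>x. if b x then f x else g x)"
proof (rule ptime_comp2[where h = "\<lambda>c x. if c then f x else g x", OF _ assms(1) ptime_ident])
  show "ptime (\<lambda>p. if fst p then f (snd p) else g (snd p))"
    by (rule ptime_dispatch[OF assms(2,3), where b = "Left (Var 0)" and e = "Right (Var 0)" and e' = "Right (Var 0)"])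
      (auto simp: enc_prod_def intro!: exI[of _ "snd _"])
qed

lemma ptime_case_list [ptime_intros]:
  fixes xs :: "'a :: encodable \<Rightarrow> 'b :: encodable list" and f :: "'a \<Rightarrow> 'c :: encodable"
  assumes "ptime xs" "ptime f" "ptime (\<lambda>p. g (fst p) (fst (snd p)) (snd (snd p)))"
  shows "ptime (\<lambda>x. case xs x of [] \<Rightarrow> f x | y # ys \<Rightarrow> g x y ys)"
proof (rule ptime_comp2[where h = "\<lambda>ys x. case ys of [] \<Rightarrow> f x | y # ys \<Rightarrow> g x y ys", OF _ assms(1) ptime_ident])
  show "ptime (\<lambda>p. case fst p of [] \<Rightarrow> f (snd p) | y # ys \<Rightarrow> g (snd p) y ys)"
  proof (rule ptime_dispatch[OF assms(3,2), where b = "Left (Var 0)" and e' = "Right (Var 0)"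
      and e = "Mk_Cell (Right (Var 0)) (Mk_Cell (Left (Left (Var 0))) (Right (Left (Var 0))))"], goal_cases)
    case (1 s p)
    then obtain x y ys where "p = (y # ys, x)"
      by (cases p; cases "fst p") auto
    with 1 show ?case
      by (intro exI[of _ "(x, y, ys)"]) auto
  next
    case (2 s p)
    then show ?case
      by (intro exI[of _ "snd p"]) (cases p; auto)
  qed
qed

lemma ptime_case_option [ptime_intros]:
  fixes a :: "'a :: encodable \<Rightarrow> 'b :: encodable option" and f :: "'a \<Rightarrow> 'c :: encodable"
  assumes "ptime a" "ptime f" "ptime (\<lambda>p. g (fst p) (snd p))"
  shows "ptime (\<lambda>x. case a x of None \<Rightarrow> f x | Some y \<Rightarrow> g x y)"
proof (rule ptime_comp2[where h = "\<lambda>a x. case a of None \<Rightarrow> f x | Some y \<Rightarrow> g x y", OF _ assms(1) ptime_ident])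
  show "ptime (\<lambda>p. case fst p of None \<Rightarrow> f (snd p) | Some y \<Rightarrow> g (snd p) y)"
  proof (rule ptime_dispatch[OF assms(3,2), where b = "Left (Var 0)" and e' = "Right (Var 0)"
      and e = "Mk_Cell (Right (Var 0)) (Right (Left (Var 0)))"], goal_cases)
    case (1 s p)
    then obtain x y where "p = (Some y, x)"
      by (cases p; cases "fst p") auto
    with 1 show ?case
      by (intro exI[of _ "(x, y)"]) auto
  next
    case (2 s p)
    then show ?case
      by (intro exI[of _ "snd p"]) (cases p; cases "fst p"; auto)
  qed
qed

lemma ptime_cong: "ptime f \<Longrightarrow> (\<And>x. f x = g x) \<Longrightarrow> ptime g"
  by (subgoal_tac "f = g") auto

lemma ptime_not [ptime_intros]: "ptime b \<Longrightarrow> ptime (\<lambda>x. \<not> b x)"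
  by (rule ptime_cong[OF ptime_if[of b "\<lambda>_. False" "\<lambda>_. True"]]) (auto intro: ptime_const)

lemma ptime_conj [ptime_intros]: "ptime a \<Longrightarrow> ptime b \<Longrightarrow> ptime (\<lambda>x. a x \<and> b x)"
  by (rule ptime_cong[OF ptime_if[of a b "\<lambda>_. False"]]) (auto intro: ptime_const)

lemma ptime_disj [ptime_intros]: "ptime a \<Longrightarrow> ptime b \<Longrightarrow> ptime (\<lambda>x. a x \<or> b x)"
  by (rule ptime_cong[OF ptime_if[of a "\<lambda>_. True" b]]) (auto intro: ptime_const)

lemma ptime_eq_0: "ptime f \<Longrightarrow> ptime (\<lambda>x. f x = (0 :: nat))"
  by (rule ptime_comp, rule ptime_dispatch[OF ptime_const[of False] ptime_const[of True],
        where b = "Var 0" and e = "Const_Atom" and e' = "Const_Atom"])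
    (auto intro!: exI[of _ "()"])

lemma ptime_null [ptime_intros]: "ptime xs \<Longrightarrow> ptime (\<lambda>x. xs x = [])"
  by (rule ptime_cong[OF ptime_case_list[of xs "\<lambda>_. True" "\<lambda>_ _ _. False"]])
    (auto intro: ptime_const split: list.splits)

section \<open>Bounded iteration and unary arithmetic\<close>

lemma fold_replicate: "fold (\<lambda>_. f) (replicate n u) = f ^^ n"
  by (induction n) (simp_all add: funpow_swap1 fun_eq_iff)

lemma ptime_funpow:
  fixes h :: "'a :: encodable \<Rightarrow> 'b :: encodable \<Rightarrow> 'b"
  assumes "ptime (\<lambda>p. h (fst p) (snd p))" "ptime n" "ptime init" "poly_bounded B"
    and "\<And>x i. i \<le> n x \<Longrightarrow> esize ((h x ^^ i) (init x)) \<le> B x"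
  shows "ptime (\<lambda>x. (h x ^^ n x) (init x))"
proof -
  \<comment> \<open>Converting a number to a list of units leaves the tree unchanged.\<close>
  have rep: "ptime (\<lambda>x. replicate (n x) ())"
    by (rule ptime_comp[OF _ assms(2)], rule ptime_expr[of _ "Var 0"])
      (auto simp: enc_replicate_unit esize_def intro: poly_bounded_esize[unfolded esize_def])
  have "ptime (\<lambda>x. fold (\<lambda>_. h x) (replicate (n x) ()) (init x))"
  proof (rule ptime_fold[OF _ rep assms(3,4)])
    show "ptime (\<lambda>p :: 'a \<times> unit \<times> 'b. h (fst p) (snd (snd p)))"
      by (rule ptime_comp2[OF assms(1)]) (intro ptime_intros)+
    fix x ys zs
    assume "replicate (n x) () = ys @ zs"
    then have "length ys \<le> n x" "ys = replicate (length ys) ()"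
      by (metis length_append length_replicate le_add1) (simp add: replicate_length_same[symmetric])
    then show "esize (fold (\<lambda>_. h x) ys (init x)) \<le> B x"
      using assms(5)[of "length ys" x] by (metis fold_replicate)
  qed
  then show ?thesis
    by (simp add: fold_replicate)
qed

lemma ptime_diff [ptime_intros]:
  fixes m n :: "'a :: encodable \<Rightarrow> nat"
  assumes "ptime m" "ptime n"
  shows "ptime (\<lambda>x. m x - n x)"
proof -
  have [simp]: "((\<lambda>k. k - Suc 0) ^^ i) j = j - i" for i j :: nat
    by (induction i) auto
  have "ptime (\<lambda>x. ((\<lambda>k. k - Suc 0) ^^ n x) (m x))"
    by (rule ptime_funpow[OF _ assms(2,1) ptime_imp_poly_bounded[OF assms(1)]])
      (intro ptime_pred ptime_intros, simp)
  then show ?thesis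
    by simp
qed

text \<open>The machine only tests for \<open>Atom\<close>; comparisons come from truncated
  subtraction, which vanishes exactly when the first number is at most the second.\<close>

lemma ptime_le [ptime_intros]:
  fixes m n :: "'a :: encodable \<Rightarrow> nat"
  shows "ptime m \<Longrightarrow> ptime n \<Longrightarrow> ptime (\<lambda>x. m x \<le> n x)"
  using ptime_eq_0[of "\<lambda>x. m x - n x"] by (simp add: ptime_diff)

lemma ptime_less [ptime_intros]:
  fixes m n :: "'a :: encodable \<Rightarrow> nat"
  shows "ptime m \<Longrightarrow> ptime n \<Longrightarrow> ptime (\<lambda>x. m x < n x)"
  using ptime_not[of "\<lambda>x. n x \<le> m x"] by (simp add: ptime_le not_le)

lemma ptime_eq_nat [ptime_intros]:
  fixes m n :: "'a :: encodable \<Rightarrow> nat"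
  shows "ptime m \<Longrightarrow> ptime n \<Longrightarrow> ptime (\<lambda>x. m x = n x)"
  unfolding eq_iff by (intro ptime_intros)

lemma ptime_add [ptime_intros]:
  fixes m n :: "'a :: encodable \<Rightarrow> nat"
  assumes "ptime m" "ptime n"
  shows "ptime (\<lambda>x. m x + n x)"
proof -
  have [simp]: "(Suc ^^ i) j = i + j" for i j :: nat
    by (induction i) auto
  have "ptime (\<lambda>x. (Suc ^^ m x) (n x))"
  proof (rule ptime_funpow[OF _ assms])
    show "poly_bounded (\<lambda>x. esize (m x) + esize (n x))"
      by (intro poly_bounded_add assms[THEN ptime_imp_poly_bounded])
  qed (intro ptime_intros, simp)
  then show ?thesis
    by simp
qed

lemma ptime_mod [ptime_intros]:
  fixes m n :: "'a :: encodable \<Rightarrow> nat"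
  assumes "ptime m" "ptime n"
  shows "ptime (\<lambda>x. m x mod n x)"
proof -
  \<comment> \<open>A counter that wraps around at \<open>j\<close>. For \<open>j = 0\<close> it
    never wraps, in accordance with \<open>i mod 0 = i\<close>.\<close>
  have [simp]: "((\<lambda>z. if Suc z = j then 0 else Suc z) ^^ i) 0 = i mod j" for i j :: nat
    by (induction i) (auto simp: mod_Suc)
  have "ptime (\<lambda>x. ((\<lambda>z. if Suc z = n x then 0 else Suc z) ^^ m x) 0)"
  proof (rule ptime_funpow[OF _ assms(1) ptime_const, where B = "\<lambda>x. esize (m x)"])
    show "ptime (\<lambda>p. if Suc (snd p) = n (fst p) then 0 else Suc (snd p))"
      by (intro ptime_intros ptime_comp[OF assms(2)])
    show "esize (((\<lambda>z. if Suc z = n x then 0 else Suc z) ^^ i) 0) \<le> esize (m x)" if "i \<le> m x" for x i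
      using that by (auto intro: order.trans[OF mod_less_eq_dividend])
  qed (rule ptime_imp_poly_bounded[OF assms(1)])
  then show ?thesis
    by simp
qed

section \<open>List operations\<close>

lemma esize_fold_Cons: "esize (fold (\<lambda>x. (#) (f x)) ys zs) = esize (map f ys) + esize zs"
  by (induction ys arbitrary: zs) auto

lemma esize_map_le:
  assumes "\<And>x. x \<in> set xs \<Longrightarrow> esize (f x) \<le> b"
  shows "esize (map f xs) \<le> length xs * (b + 1)"
  using esize_list_le[of "map f xs" b] assms by auto

lemma ptime_append_rev:
  fixes xs ys :: "'a :: encodable \<Rightarrow> 'b :: encodable list"
  assumes "ptime xs" "ptime ys"
  shows "ptime (\<lambda>x. rev (xs x) @ ys x)"
proof -
  have "ptime (\<lambda>x. fold Cons (xs x) (ys x))"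
  proof (rule ptime_fold[OF _ assms, where B = "\<lambda>x. esize (xs x) + esize (ys x)"])
    show "esize (fold Cons us (ys x)) \<le> esize (xs x) + esize (ys x)" if "xs x = us @ vs" for x us vs
      using that by (simp add: fold_Cons_rev)
  qed (intro ptime_intros poly_bounded_add assms[THEN ptime_imp_poly_bounded])+
  then show ?thesis
    by (simp add: fold_Cons_rev)
qed

lemma ptime_rev [ptime_intros]: "ptime xs \<Longrightarrow> ptime (\<lambda>x. rev (xs x))"
  using ptime_append_rev[of xs "\<lambda>_. []"] by (simp add: ptime_const)

lemma ptime_append [ptime_intros]: "ptime xs \<Longrightarrow> ptime ys \<Longrightarrow> ptime (\<lambda>x. xs x @ ys x)"
  using ptime_append_rev[of "\<lambda>x. rev (xs x)" ys] by (simp add: ptime_rev)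

lemma ptime_map [ptime_intros]:
  fixes f :: "'a :: encodable \<Rightarrow> 'b :: encodable \<Rightarrow> 'c :: encodable"
  assumes "ptime (\<lambda>p. f (fst p) (snd p))" "ptime xs"
  shows "ptime (\<lambda>x. map (f x) (xs x))"
proof -
  from ptime_imp_poly_bounded[OF assms(1)] obtain k where
    k: "\<And>p. esize (f (fst p) (snd p)) \<le> (esize p + 2) ^ k"
    unfolding poly_bounded_def by blast
  let ?b = "\<lambda>x. (esize x + esize (xs x) + 3) ^ k"
  let ?B = "\<lambda>x. esize (xs x) * (?b x + 1)"
  have "ptime (\<lambda>x. fold (\<lambda>y. (#) (f x y)) (xs x) [])"
  proof (rule ptime_fold[OF _ assms(2) ptime_const, where B = ?B])
    show "ptime (\<lambda>p :: 'a \<times> 'b \<times> 'c list. f (fst p) (fst (snd p)) # snd (snd p))"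
      by (intro ptime_intros ptime_comp2[OF assms(1)])
    show "poly_bounded ?B"
      by (intro poly_bounded_intros ptime_imp_poly_bounded[OF assms(2)])
    fix x ys zs
    assume xs: "xs x = ys @ zs"
    have "esize (f x y) \<le> ?b x" if "y \<in> set ys" for y
    proof -
      have "esize y \<le> esize (xs x)"
        using that xs by (intro esize_member) simp
      then have "(esize (x, y) + 2) ^ k \<le> ?b x"
        by (intro power_mono) auto
      with k[of "(x, y)"] show ?thesis
        by simp
    qed
    then have "esize (map (f x) ys) \<le> length ys * (?b x + 1)"
      by (rule esize_map_le)
    also have "\<dots> \<le> ?B x"
      using length_le_esize[of "xs x"] by (intro mult_right_mono) (simp_all add: xs)
    finally show "esize (fold (\<lambda>y. (#) (f x y)) ys []) \<le> ?B x"
      by (simp add: esize_fold_Cons)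
  qed
  moreover have "fold (\<lambda>y. (#) (f x y)) ys [] = rev (map (f x) ys)" for x ys
    by (induction ys rule: rev_induct) auto
  ultimately have "ptime (\<lambda>x. rev (map (f x) (xs x)))"
    by simp
  from ptime_rev[OF this] show ?thesis
    by simp
qed

lemma ptime_concat [ptime_intros]:
  fixes xss :: "'a :: encodable \<Rightarrow> 'b :: encodable list list"
  assumes "ptime xss"
  shows "ptime (\<lambda>x. concat (xss x))"
proof -
  have fold: "fold (\<lambda>ys zs. zs @ ys) yss zs = zs @ concat yss" for yss :: "'b list list" and zs
    by (induction yss arbitrary: zs) auto
  have esize: "esize (concat yss) \<le> esize yss" for yss :: "'b list list"
    by (induction yss) auto
  have "ptime (\<lambda>x. fold (\<lambda>ys zs. zs @ ys) (xss x) [])"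
  proof (rule ptime_fold[OF _ assms ptime_const, where B = "\<lambda>x. esize (xss x)"])
    show "esize (fold (\<lambda>ys zs. zs @ ys) us []) \<le> esize (xss x)" if "xss x = us @ vs" for x us vs
      using that esize[of us] by (simp add: fold)
  qed (intro ptime_intros assms[THEN ptime_imp_poly_bounded])+
  then show ?thesis
    by (simp add: fold)
qed

lemma ptime_filter [ptime_intros]:
  assumes "ptime (\<lambda>p. f (fst p) (snd p))" "ptime xs"
  shows "ptime (\<lambda>x. filter (f x) (xs x))"
proof -
  have "filter (f x) ys = concat (map (\<lambda>y. if f x y then [y] else []) ys)" for x ys
    by (induction ys) auto
  moreover have "ptime (\<lambda>x. concat (map (\<lambda>y. if f x y then [y] else []) (xs x)))"
    by (intro ptime_intros assms)
  ultimately show ?thesis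
    by simp
qed

lemma ptime_list_all [ptime_intros]:
  assumes "ptime (\<lambda>p. f (fst p) (snd p))" "ptime xs"
  shows "ptime (\<lambda>x. list_all (f x) (xs x))"
proof -
  have "list_all (f x) ys \<longleftrightarrow> filter (\<lambda>y. \<not> f x y) ys = []" for x ys
    by (simp add: list_all_iff filter_empty_conv)
  moreover have "ptime (\<lambda>x. filter (\<lambda>y. \<not> f x y) (xs x) = [])"
    by (intro ptime_intros assms)
  ultimately show ?thesis
    by simp
qed

lemma ptime_length [ptime_intros]:
  fixes xs :: "'a :: encodable \<Rightarrow> 'b :: encodable list"
  assumes "ptime xs"
  shows "ptime (\<lambda>x. length (xs x))"
proof -
  have fold: "fold (\<lambda>_. Suc) ys n = n + length ys" for ys :: "'b list" and n
    by (induction ys arbitrary: n) auto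
  have "ptime (\<lambda>x. fold (\<lambda>_. Suc) (xs x) 0)"
  proof (rule ptime_fold[OF _ assms ptime_const, where B = "\<lambda>x. esize (xs x)"])
    show "esize (fold (\<lambda>_. Suc) us 0) \<le> esize (xs x)" if "xs x = us @ vs" for x us vs
      using length_le_esize[of "xs x"] that by (simp add: fold)
  qed (intro ptime_intros assms[THEN ptime_imp_poly_bounded])+
  then show ?thesis
    by (simp add: fold)
qed

lemma ptime_sum_list [ptime_intros]:
  fixes xs :: "'a :: encodable \<Rightarrow> nat list"
  assumes "ptime xs"
  shows "ptime (\<lambda>x. sum_list (xs x))"
proof -
  have esize: "sum_list ys \<le> esize ys" for ys :: "nat list"
    by (induction ys) auto
  have fold: "fold (+) ys n = n + sum_list ys" for ys :: "nat list" and n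
    by (induction ys arbitrary: n) auto
  have "ptime (\<lambda>x. fold (+) (xs x) 0)"
  proof (rule ptime_fold[OF _ assms ptime_const, where B = "\<lambda>x. esize (xs x)"])
    show "esize (fold (+) us 0) \<le> esize (xs x)" if "xs x = us @ vs" for x us vs
      using esize[of us] that by (simp add: fold)
  qed (intro ptime_intros assms[THEN ptime_imp_poly_bounded])+
  then show ?thesis
    by (simp add: fold)
qed

lemma ptime_upt [ptime_intros]:
  fixes m n :: "'a :: encodable \<Rightarrow> nat"
  assumes "ptime m" "ptime n"
  shows "ptime (\<lambda>x. [m x..<n x])"
proof -
  \<comment> \<open>The accumulated list serves as its own counter: the next element is its current
    length.\<close>
  have *: "((\<lambda>l. length l # l) ^^ i) [] = rev [0..<i]" for i
    by (induction i) auto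
  have "ptime (\<lambda>x. ((\<lambda>l. length l # l) ^^ (n x - m x)) [])"
  proof (rule ptime_funpow[OF _ ptime_diff[OF assms(2,1)] ptime_const, where B = "\<lambda>x. esize (n x) * (esize (n x) + 1)"])
    fix x i
    assume "i \<le> n x - m x"
    have "esize [0..<i] \<le> length [0..<i] * (i + 1)"
      by (rule esize_list_le) auto
    also have "\<dots> \<le> esize (n x) * (esize (n x) + 1)"
      using \<open>i \<le> n x - m x\<close> by (intro mult_mono) auto
    finally show "esize (((\<lambda>l. length l # l) ^^ i) []) \<le> esize (n x) * (esize (n x) + 1)"
      by (simp add: *)
  qed (intro ptime_intros poly_bounded_intros ptime_imp_poly_bounded[OF assms(2)])+
  then have "ptime (\<lambda>x. [0..<n x - m x])"
    using ptime_rev by (fastforce simp: *)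
  then have "ptime (\<lambda>x. map (\<lambda>i. i + m x) [0..<n x - m x])"
    by (intro ptime_intros ptime_comp[OF assms(1)])
  moreover have "map (\<lambda>i. i + k) [0..<l - k] = [k..<l]" for k l
    by (cases "k \<le> l") (simp_all add: map_add_upt)
  ultimately show ?thesis
    by simp
qed

lemma ptime_nth_default [ptime_intros]:
  fixes xs :: "'a :: encodable \<Rightarrow> 'b :: encodable list"
  assumes "ptime d" "ptime xs" "ptime n"
  shows "ptime (\<lambda>x. nth_default (d x) (xs x) (n x))"
proof -
  have tl: "(tl ^^ i) ys = drop i ys" for i and ys :: "'b list"
    by (induction i) (auto simp: drop_Suc tl_drop)
  have esize: "esize (drop i ys) \<le> esize ys" for i and ys :: "'b list"
    using esize_append[of "take i ys" "drop i ys"] by (simp del: esize_append)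
  have "ptime (\<lambda>x. (tl ^^ n x) (xs x))"
    by (rule ptime_funpow[OF _ assms(3,2) ptime_imp_poly_bounded[OF assms(2)]])
      (intro ptime_intros, simp add: tl esize)
  then have "ptime (\<lambda>x. case drop (n x) (xs x) of [] \<Rightarrow> d x | y # ys \<Rightarrow> y)"
    unfolding tl by (intro ptime_intros assms)
  moreover have "nth_default e ys i = (case drop i ys of [] \<Rightarrow> e | y # zs \<Rightarrow> y)"
    for e and ys :: "'b list" and i
    by (auto simp: nth_default_def Cons_nth_drop_Suc[symmetric])
  ultimately show ?thesis
    by (simp only:)
qed

text \<open>The seed \<open>z\<close> makes the maximum total, and the accumulator is always
  \<open>z\<close> or a list element, which gives the size bound that \<open>ptime_fold\<close>
  requires.\<close>

definition argmax :: "('a \<Rightarrow> nat) \<Rightarrow> 'a \<Rightarrow> 'a list \<Rightarrow> 'a" where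
  "argmax f z xs = fold (\<lambda>x z. if f z < f x then x else z) xs z"

lemma argmax_mem: "argmax f z xs \<in> insert z (set xs)"
  unfolding argmax_def by (induction xs arbitrary: z) (simp, fastforce)

lemma argmax_ge_init: "f z \<le> f (argmax f z xs)"
proof (induction xs arbitrary: z)
  case (Cons x xs)
  from Cons[of x] Cons[of z] show ?case
    by (auto simp: argmax_def)
qed (simp add: argmax_def)

lemma argmax_ge: "x \<in> set xs \<Longrightarrow> f x \<le> f (argmax f z xs)"
proof (induction xs arbitrary: z)
  case (Cons y ys)
  have "argmax f z (y # ys) = argmax f (if f z < f y then y else z) ys"
    by (simp add: argmax_def)
  with Cons argmax_ge_init[of f "if f z < f y then y else z" ys] show ?case
    by (auto split: if_splits)
qed simp

lemma ptime_argmax [ptime_intros]: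
  fixes xs :: "'a :: encodable \<Rightarrow> 'b :: encodable list"
  assumes "ptime (\<lambda>p. f (fst p) (snd p))" "ptime z" "ptime xs"
  shows "ptime (\<lambda>x. argmax (f x) (z x) (xs x))"
  unfolding argmax_def
proof (rule ptime_fold[OF _ assms(3,2), where B = "\<lambda>x. esize (z x) + esize (xs x)"])
  show "ptime (\<lambda>p. if f (fst p) (snd (snd p)) < f (fst p) (fst (snd p)) then fst (snd p) else snd (snd p))"
    by (intro ptime_intros ptime_comp2[OF assms(1)])
  show "poly_bounded (\<lambda>x. esize (z x) + esize (xs x))"
    by (intro poly_bounded_intros assms(2,3)[THEN ptime_imp_poly_bounded])
  fix x us vs
  assume xs: "xs x = us @ vs"
  have "argmax (f x) (z x) us \<in> insert (z x) (set (xs x))"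
    using argmax_mem[of "f x" "z x" us] xs by auto
  then have "esize (argmax (f x) (z x) us) \<le> esize (z x) + esize (xs x)"
    by (auto dest: esize_member)
  then show "esize (fold (\<lambda>y z. if f x z < f x y then y else z) us (z x)) \<le> esize (z x) + esize (xs x)"
    by (simp add: argmax_def)
qed

lemma ptime_imp_program:
  assumes "ptime f"
  obtains c P where "\<And>x. \<exists>t. runs c (enc x) t (enc (f x)) \<and> t \<le> poly P (size (enc x))"
proof -
  from assms obtain c v T where c: "poly_bounded T" "computes c v T f"
    by (rule ptimeE)
  then obtain k where k: "\<And>x. T x \<le> (esize x + 2) ^ k"
    unfolding poly_bounded_def by blast
  \<comment> \<open>\<open>[:2, 1:]\<close> is the polynomial X + 2.\<close>
  have "\<exists>t. runs c (enc x) t (enc (f x)) \<and> t \<le> poly ([:2, 1:] ^ k) (size (enc x))" for x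
  proof -
    have "initial_store (enc x) 0 = enc x"
      by (simp add: initial_store_def)
    from computesD[OF c(2), of "initial_store (enc x)" x, OF this] obtain t s where
      "exec c (initial_store (enc x)) t s" "s 0 = enc (f x)" "t \<le> T x"
      by blast
    with k[of x] show ?thesis
      by (auto simp: runs_def esize_def poly_power add.commute intro!: exI[of _ t])
  qed
  then show thesis
    by (rule that)
qed

section \<open>The algorithm\<close>

text \<open>The value 0 stands for a non-edge; label \<open>x\<close> is at position \<open>x - 1\<close> of a projection table.\<close>

definition proj_label :: "nat list option list list \<Rightarrow> nat \<Rightarrow> nat \<Rightarrow> nat \<Rightarrow> nat" where
  "proj_label R a b x =
    (case nth_default None (nth_default [] R a) b of None \<Rightarrow> 0 | Some t \<Rightarrow> nth_default 0 t (x - 1))"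

text \<open>
  The partial labelling \<open>M\<close> has at position \<open>b\<close> the label of the right vertex \<open>b\<close>, where 0 means that
  there is none. Positions beyond its end read as 0, so the empty list labels nothing.
\<close>

definition condition :: "nat list option list list \<Rightarrow> nat \<Rightarrow> nat \<Rightarrow> nat \<Rightarrow> nat list \<Rightarrow> nat list" where
  "condition R r a x M =
    map (\<lambda>b. if proj_label R a b x = 0 then nth_default 0 M b else proj_label R a b x) [0..<r]"

definition consistent_labels :: "nat list option list list \<Rightarrow> nat \<Rightarrow> nat \<Rightarrow> nat list \<Rightarrow> nat \<Rightarrow> nat list" where
  "consistent_labels R r q M a =
    filter (\<lambda>x. list_all (\<lambda>b. proj_label R a b x = 0 \<or> nth_default 0 M b = 0 \<or>
      proj_label R a b x = nth_default 0 M b) [0..<r]) [1..<Suc q]"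

text \<open>
  Choosing uniformly from a nonempty list \<open>L\<close> of at most \<open>q\<close> labels is replaced by choosing uniformly from
  its cyclic repetition of length exactly \<open>q\<close>. No frequency drops by more than a factor 2, and
  expected numbers of votes become integers over the common denominator \<open>q\<close>.
\<close>

definition spread :: "nat \<Rightarrow> nat list \<Rightarrow> nat list" where
  "spread q L = map (\<lambda>i. nth_default 0 L (i mod length L)) [0..<q]"

text \<open>For a label \<open>y\<close>, this is \<open>q\<close> times the expected number of
  neighbours of \<open>b\<close> voting for \<open>y\<close>. Non-neighbours project to 0 and never
  vote for a label.\<close>

definition votes :: "nat list option list list \<Rightarrow> nat \<Rightarrow> nat \<Rightarrow> nat \<Rightarrow> nat list \<Rightarrow> nat \<Rightarrow> nat \<Rightarrow> nat" where
  "votes R l r q M b y = sum_list (map (\<lambda>a.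
    length (filter (\<lambda>x. proj_label R a b x = y) (spread q (consistent_labels R r q M a)))) [0..<l])"

definition right_labels :: "nat list option list list \<Rightarrow> nat \<Rightarrow> nat \<Rightarrow> nat \<Rightarrow> nat list \<Rightarrow> nat list" where
  "right_labels R l r q M = map (\<lambda>b. argmax (\<lambda>y. votes R l r q M b y) 1 [1..<Suc q]) [0..<r]"

text \<open>Counts satisfied edges only: right labels are positive, so the 0 of a non-edge never
  matches.\<close>

definition gain :: "nat list option list list \<Rightarrow> nat \<Rightarrow> nat list \<Rightarrow> nat \<Rightarrow> nat \<Rightarrow> nat" where
  "gain R r ys a x = length (filter (\<lambda>b. proj_label R a b x = nth_default 0 ys b) [0..<r])"

text \<open>Derandomises the left side. With the right labels fixed the left vertices are
  independent of each other, and a best label is no worse than a random one.\<close>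

definition left_labels :: "nat list option list list \<Rightarrow> nat \<Rightarrow> nat \<Rightarrow> nat \<Rightarrow> nat list \<Rightarrow> nat list" where
  "left_labels R l r q ys = map (\<lambda>a. argmax (\<lambda>x. gain R r ys a x) 1 [1..<Suc q]) [0..<l]"

definition rounding :: "nat list option list list \<Rightarrow> nat \<Rightarrow> nat \<Rightarrow> nat \<Rightarrow> nat list \<Rightarrow> nat list \<times> nat list" where
  "rounding R l r q M = (left_labels R l r q (right_labels R l r q M), right_labels R l r q M)"

definition score :: "nat list option list list \<Rightarrow> nat \<Rightarrow> nat \<Rightarrow> nat list \<times> nat list \<Rightarrow> nat" where
  "score R l r \<phi> = sum_list (map (\<lambda>a. gain R r (snd \<phi>) a (nth_default 0 (fst \<phi>) a)) [0..<l])"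

text \<open>Keeping \<open>Ms\<close> lets \<open>k\<close> rounds cover all sequences of at most
  \<open>k\<close> guesses. A round multiplies the number of candidates by
  \<open>1 + l * q\<close>.\<close>

definition refine :: "nat list option list list \<Rightarrow> nat \<Rightarrow> nat \<Rightarrow> nat \<Rightarrow> nat list list \<Rightarrow> nat list list" where
  "refine R l r q Ms = Ms @ concat (map (\<lambda>M. concat (map (\<lambda>a.
    map (\<lambda>x. condition R r a x M) [1..<Suc q]) [0..<l])) Ms)"

text \<open>The exponent \<open>k\<close> is fixed in the program and not part of the input; it will
  depend on \<open>\<gamma>\<close> only.\<close>

definition solve :: "nat \<Rightarrow> nat \<times> nat \<times> nat \<times> nat list option list list \<Rightarrow> nat list \<times> nat list" where
  "solve k = (\<lambda>(l, r, q, R). argmax (\<lambda>\<phi>. score R l r \<phi>) (rounding R l r q [])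
    (map (\<lambda>M. rounding R l r q M) ((refine R l r q ^^ k) [[]])))"

section \<open>Polynomial running time of the algorithm\<close>

lemma ptime_proj_label [ptime_intros]:
  assumes "ptime R" "ptime a" "ptime b" "ptime x"
  shows "ptime (\<lambda>c. proj_label (R c) (a c) (b c) (x c))"
  \<comment> \<open>Under a binder the argument becomes a tuple extending \<open>c\<close>;
    \<open>ptime_comp\<close> composes the assumptions with the projection back to
    \<open>c\<close>.\<close>
  unfolding proj_label_def by (intro ptime_intros assms[THEN ptime_comp])

lemma ptime_condition [ptime_intros]:
  assumes "ptime R" "ptime r" "ptime a" "ptime x" "ptime M"
  shows "ptime (\<lambda>c. condition (R c) (r c) (a c) (x c) (M c))"
  unfolding condition_def by (intro ptime_intros assms[THEN ptime_comp])

lemma ptime_consistent_labels [ptime_intros]: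
  assumes "ptime R" "ptime r" "ptime q" "ptime M" "ptime a"
  shows "ptime (\<lambda>c. consistent_labels (R c) (r c) (q c) (M c) (a c))"
  unfolding consistent_labels_def by (intro ptime_intros assms[THEN ptime_comp])

lemma ptime_spread [ptime_intros]:
  assumes "ptime q" "ptime L"
  shows "ptime (\<lambda>c. spread (q c) (L c))"
  unfolding spread_def by (intro ptime_intros assms[THEN ptime_comp])

lemma ptime_votes [ptime_intros]:
  assumes "ptime R" "ptime l" "ptime r" "ptime q" "ptime M" "ptime b" "ptime y"
  shows "ptime (\<lambda>c. votes (R c) (l c) (r c) (q c) (M c) (b c) (y c))"
  unfolding votes_def by (intro ptime_intros assms[THEN ptime_comp])

lemma ptime_right_labels [ptime_intros]:
  assumes "ptime R" "ptime l" "ptime r" "ptime q" "ptime M"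
  shows "ptime (\<lambda>c. right_labels (R c) (l c) (r c) (q c) (M c))"
  unfolding right_labels_def by (intro ptime_intros assms[THEN ptime_comp])

lemma ptime_gain [ptime_intros]:
  assumes "ptime R" "ptime r" "ptime ys" "ptime a" "ptime x"
  shows "ptime (\<lambda>c. gain (R c) (r c) (ys c) (a c) (x c))"
  unfolding gain_def by (intro ptime_intros assms[THEN ptime_comp])

lemma ptime_left_labels [ptime_intros]:
  assumes "ptime R" "ptime l" "ptime r" "ptime q" "ptime ys"
  shows "ptime (\<lambda>c. left_labels (R c) (l c) (r c) (q c) (ys c))"
  unfolding left_labels_def by (intro ptime_intros assms[THEN ptime_comp])

lemma ptime_rounding [ptime_intros]:
  assumes "ptime R" "ptime l" "ptime r" "ptime q" "ptime M"
  shows "ptime (\<lambda>c. rounding (R c) (l c) (r c) (q c) (M c))"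
  unfolding rounding_def by (intro ptime_intros assms)

lemma ptime_score [ptime_intros]:
  assumes "ptime R" "ptime l" "ptime r" "ptime \<phi>"
  shows "ptime (\<lambda>c. score (R c) (l c) (r c) (\<phi> c))"
  unfolding score_def by (intro ptime_intros assms[THEN ptime_comp])

lemma ptime_refine [ptime_intros]:
  assumes "ptime R" "ptime l" "ptime r" "ptime q" "ptime Ms"
  shows "ptime (\<lambda>c. refine (R c) (l c) (r c) (q c) (Ms c))"
  unfolding refine_def by (intro ptime_intros assms[THEN ptime_comp])

text \<open>Composition of a constant number of functions. \<open>ptime_funpow\<close> with a
  variable count is not applicable, as the candidates multiply in every round.\<close>

lemma ptime_funpow_refine [ptime_intros]:
  assumes "ptime R" "ptime l" "ptime r" "ptime q" "ptime Ms"
  shows "ptime (\<lambda>c. (refine (R c) (l c) (r c) (q c) ^^ k) (Ms c))"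
  using assms by (induction k) (auto intro: ptime_refine)

lemma ptime_solve: "ptime (solve k)"
  unfolding solve_def case_prod_beta by (intro ptime_intros)

section \<open>Candidates and frequencies in the cyclic repetition\<close>

lemma length_spread [simp]: "length (spread q L) = q"
  by (simp add: spread_def)

lemma set_refine: "set (refine R l r q Ms) =
    set Ms \<union> (\<Union>M\<in>set Ms. \<Union>a<l. (\<lambda>x. condition R r a x M) ` {1..q})"
  by (simp add: refine_def atLeast0LessThan atLeastLessThanSuc_atLeastAtMost del: upt_Suc)

lemma length_filter_sum: "length (filter P xs) = (\<Sum>i<length xs. of_bool (P (xs ! i)))"
proof -
  have "{..<length xs} \<inter> {i. P (xs ! i)} = {i. i < length xs \<and> P (xs ! i)}"
    by auto
  then show ?thesis
    by (simp only: length_filter_conv_card sum_of_bool_eq finite_lessThan of_nat_id)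
qed

lemma spread_add_length:
  assumes "L \<noteq> []"
  shows "spread (length L + q) L = L @ spread q L"
proof -
  have "[0..<length L + q] = [0..<length L] @ map (\<lambda>i. i + length L) [0..<q]"
    using upt_add_eq_append[of 0 "length L" q] map_add_upt[of "length L" q] by (simp add: add.commute)
  moreover have "map (\<lambda>i. nth_default 0 L (i mod length L)) [0..<length L] = L"
    by (rule nth_equalityI) (simp_all add: nth_default_nth)
  ultimately show ?thesis
    by (simp add: spread_def comp_def)
qed

text \<open>The repetition contains \<open>q div length L\<close> full copies of \<open>L\<close>.
  Since there is at least one, the remainder is shorter than the full copies together, so these fill
  at least half of the \<open>q\<close> positions.\<close>

lemma spread_frequency:
  assumes "0 < length L" "length L \<le> q"
  shows "q * length (filter P L) \<le> 2 * length L * length (filter P (spread q L))"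
proof -
  have *: "k * length (filter P L) \<le> length (filter P (spread m L))" if "length L * k \<le> m" for k m
    using that
  proof (induction k arbitrary: m)
    case (Suc k)
    then have "m = length L + (m - length L)" "length L * k \<le> m - length L"
      by auto
    with Suc.IH[of "m - length L"] spread_add_length[of L "m - length L"] assms(1) show ?case
      by (metis add_le_cancel_left filter_append length_append length_greater_0_conv mult_Suc)
  qed simp
  have "q = length L * (q div length L) + q mod length L"
    by simp
  moreover have "q mod length L < length L"
    using assms(1) by simp
  moreover have "length L * 1 \<le> length L * (q div length L)"
    using assms by (intro mult_left_mono) (simp_all add: div_greater_zero_iff Suc_le_eq)
  ultimately have "q \<le> 2 * length L * (q div length L)"
    by linarith
  then have "q * length (filter P L) \<le> 2 * length L * (q div length L) * length (filter P L)"
    by (rule mult_right_mono) simp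
  also have "\<dots> = 2 * length L * (q div length L * length (filter P L))"
    by simp
  also have "\<dots> \<le> 2 * length L * length (filter P (spread q L))"
    by (intro mult_left_mono *) simp_all
  finally show ?thesis .
qed

section \<open>Analysis relative to a fixed satisfying assignment\<close>

locale satisfied_game =
  fixes R :: "nat list option list list" and l r q :: nat and E :: "(nat \<times> nat) set"
    and \<sigma> \<tau> :: "nat \<Rightarrow> nat"
  assumes edges_subset: "E \<subseteq> {..<l} \<times> {..<r}"
    and proj_non_edge: "\<lbrakk>a < l; b < r; (a, b) \<notin> E\<rbrakk> \<Longrightarrow> proj_label R a b x = 0"
    and proj_edge: "\<lbrakk>(a, b) \<in> E; x \<in> {1..q}\<rbrakk> \<Longrightarrow> proj_label R a b x \<in> {1..q}"
    and proj_\<sigma>: "(a, b) \<in> E \<Longrightarrow> proj_label R a b (\<sigma> a) = \<tau> b"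
    and \<sigma>_label: "a < l \<Longrightarrow> \<sigma> a \<in> {1..q}"
    and \<tau>_label: "b < r \<Longrightarrow> \<tau> b \<in> {1..q}"
begin

definition sound :: "nat list \<Rightarrow> bool" where
  "sound M \<longleftrightarrow> (\<forall>b<r. nth_default 0 M b \<in> {0, \<tau> b})"

definition lab :: "nat list \<Rightarrow> nat \<Rightarrow> nat set" where
  "lab M a = set (consistent_labels R r q M a)"

definition good_frac :: "nat list \<Rightarrow> nat \<Rightarrow> nat \<Rightarrow> real" where
  "good_frac M a b = card {x \<in> lab M a. proj_label R a b x = \<tau> b} / card (lab M a)"

lemma lab_eq: "lab M a = {x \<in> {1..q}. \<forall>b<r. proj_label R a b x = 0 \<or> nth_default 0 M b = 0 \<or>
    proj_label R a b x = nth_default 0 M b}"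
  by (auto simp: lab_def consistent_labels_def list_all_iff Ball_def)

lemma lab_subset: "lab M a \<subseteq> {1..q}"
  by (auto simp: lab_eq)

lemma finite_lab: "finite (lab M a)"
  by (simp add: lab_def)

lemma card_lab: "card (lab M a) = length (consistent_labels R r q M a)"
  unfolding lab_def by (rule distinct_card) (simp add: consistent_labels_def)

lemma finite_edges: "finite E"
  using edges_subset by (rule finite_subset) auto

text \<open>\<open>M\<close> only carries labels of \<open>\<tau>\<close>, and those are what
  \<open>\<sigma> a\<close> projects to. Thus label sets never become empty, and their logarithms
  stay nonnegative.\<close>

lemma \<sigma>_mem_lab:
  assumes "sound M" "a < l"
  shows "\<sigma> a \<in> lab M a"
proof -
  have "proj_label R a b (\<sigma> a) = 0 \<or> nth_default 0 M b = 0 \<or> proj_label R a b (\<sigma> a) = nth_default 0 M b"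
    if "b < r" for b
    using assms that proj_\<sigma>[of a b] proj_non_edge[of a b]
    by (cases "(a, b) \<in> E") (auto simp: sound_def)
  with \<sigma>_label[OF assms(2)] show ?thesis
    by (auto simp: lab_eq)
qed

lemma card_lab_pos: "sound M \<Longrightarrow> a < l \<Longrightarrow> 0 < card (lab M a)"
  using \<sigma>_mem_lab[of M a] finite_lab[of M a] by (auto simp: card_gt_0_iff)

lemma condition_nth: "b < r \<Longrightarrow> nth_default 0 (condition R r a x M) b =
    (if proj_label R a b x = 0 then nth_default 0 M b else proj_label R a b x)"
  by (simp add: condition_def nth_default_nth)

lemma proj_\<sigma>_cases: "a < l \<Longrightarrow> b < r \<Longrightarrow> proj_label R a b (\<sigma> a) \<in> {0, \<tau> b}"
  using proj_\<sigma>[of a b] proj_non_edge[of a b] by (cases "(a, b) \<in> E") auto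

lemma sound_condition:
  assumes "sound M" "a < l"
  shows "sound (condition R r a (\<sigma> a) M)"
  unfolding sound_def
proof (intro allI impI)
  fix b
  assume "b < r"
  with assms(1) proj_\<sigma>_cases[OF assms(2) this]
  show "nth_default 0 (condition R r a (\<sigma> a) M) b \<in> {0, \<tau> b}"
    by (auto simp: condition_nth sound_def)
qed

text \<open>Conditioning on \<open>a'\<close> writes \<open>\<tau> b\<close> at the common neighbour
  \<open>b\<close>, which forces the labels of \<open>a\<close> to project there. Old constraints
  survive because, by soundness, an overwritten label is replaced by itself.\<close>

lemma lab_condition:
  assumes "sound M" "a' < l" "a < l" "(a, b) \<in> E" "(a', b) \<in> E"
  shows "lab (condition R r a' (\<sigma> a') M) a \<subseteq> {x \<in> lab M a. proj_label R a b x = \<tau> b}"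
proof
  fix x
  assume x: "x \<in> lab (condition R r a' (\<sigma> a') M) a"
  have "proj_label R a i x = 0 \<or> nth_default 0 M i = 0 \<or> proj_label R a i x = nth_default 0 M i"
    if "i < r" for i
  proof -
    have "nth_default 0 M i = 0 \<or> nth_default 0 M i = \<tau> i"
      using assms(1) that by (simp add: sound_def)
    moreover have "proj_label R a i x = 0 \<or> nth_default 0 (condition R r a' (\<sigma> a') M) i = 0 \<or>
        proj_label R a i x = nth_default 0 (condition R r a' (\<sigma> a') M) i"
      using x that by (simp add: lab_eq)
    ultimately show ?thesis
      using proj_\<sigma>_cases[OF assms(2) that] that by (auto simp: condition_nth split: if_splits)
  qed
  then have "x \<in> lab M a"
    using x by (auto simp: lab_eq)
  moreover have "proj_label R a b x = \<tau> b"
  proof -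
    have "b < r"
      using edges_subset assms(4) by auto
    moreover have "proj_label R a b x \<noteq> 0"
      using proj_edge[OF assms(4), of x] x lab_subset by fastforce
    moreover have "\<tau> b \<noteq> 0"
      using \<tau>_label[OF \<open>b < r\<close>] by auto
    ultimately show ?thesis
      using x proj_\<sigma>[OF assms(5)] by (auto simp: lab_eq condition_nth)
  qed
  ultimately show "x \<in> {x \<in> lab M a. proj_label R a b x = \<tau> b}"
    by simp
qed

lemma card_lab_condition_le:
  assumes "sound M" "a' < l" "a < l" "(a, b) \<in> E" "(a', b) \<in> E"
  shows "card (lab (condition R r a' (\<sigma> a') M) a) / card (lab M a) \<le> good_frac M a b"
  unfolding good_frac_def
  by (intro divide_right_mono of_nat_mono card_mono lab_condition assms) (simp_all add: finite_lab)

lemma length_consistent_labels_le: "length (consistent_labels R r q M a) \<le> q"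
  using card_mono[OF _ lab_subset[of M a]] by (simp add: card_lab)

lemma good_frac_eq:
  "good_frac M a b = length (filter (\<lambda>x. proj_label R a b x = \<tau> b) (consistent_labels R r q M a)) /
    length (consistent_labels R r q M a)"
proof -
  have "card {x \<in> lab M a. proj_label R a b x = \<tau> b} =
      length (filter (\<lambda>x. proj_label R a b x = \<tau> b) (consistent_labels R r q M a))"
    unfolding lab_def by (subst distinct_card[symmetric]) (simp_all add: consistent_labels_def)
  then show ?thesis
    by (simp add: good_frac_def card_lab)
qed

lemma good_frac_nonneg: "0 \<le> good_frac M a b"
  by (simp add: good_frac_def)

text \<open>The expected number of satisfied edges if the right side carries \<open>\<tau>\<close>
  and each left label is uniform in \<open>lab M a\<close>.\<close>

definition total :: "nat list \<Rightarrow> real" where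
  "total M = (\<Sum>a<l. \<Sum>b<r. of_bool ((a, b) \<in> E) * good_frac M a b)"

lemma votes_sum: "votes R l r q M b y =
    (\<Sum>a<l. \<Sum>i<q. of_bool (proj_label R a b (spread q (consistent_labels R r q M a) ! i) = y))"
  by (simp add: votes_def length_filter_sum interv_sum_list_conv_sum_set_nat atLeast0LessThan del: sum_of_bool_eq)

lemma gain_sum: "gain R r ys a x = (\<Sum>b<r. of_bool (proj_label R a b x = nth_default 0 ys b))"
  by (simp add: gain_def length_filter_sum del: sum_of_bool_eq)

lemma spread_nth_mem:
  assumes "sound M" "a < l" "i < q"
  shows "spread q (consistent_labels R r q M a) ! i \<in> {1..q}"
proof -
  let ?L = "consistent_labels R r q M a"
  have "0 < length ?L"
    using card_lab_pos[OF assms(1,2)] by (simp add: card_lab)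
  then have "i mod length ?L < length ?L"
    by simp
  then have "spread q ?L ! i \<in> set ?L"
    using assms(3) by (simp add: spread_def nth_default_nth)
  then show ?thesis
    using lab_subset[of M a] by (auto simp: lab_def)
qed

text \<open>The factor \<open>q\<close> is the common denominator of the votes, and the 2 is the
  loss of the cyclic repetition.\<close>

lemma total_le_votes:
  assumes "sound M"
  shows "real q * total M \<le> 2 * (\<Sum>b<r. votes R l r q M b (\<tau> b))"
proof -
  let ?n = "\<lambda>a b. length (filter (\<lambda>x. proj_label R a b x = \<tau> b) (spread q (consistent_labels R r q M a)))"
  have "real q * (of_bool ((a, b) \<in> E) * good_frac M a b) \<le> 2 * real (?n a b)" if "a < l" for a b
  proof -
    let ?L = "consistent_labels R r q M a"
    have pos: "0 < length ?L"
      using card_lab_pos[OF assms that] by (simp add: card_lab)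
    have "real (q * length (filter (\<lambda>x. proj_label R a b x = \<tau> b) ?L)) \<le> real (2 * length ?L * ?n a b)"
      by (intro of_nat_mono spread_frequency pos length_consistent_labels_le)
    then have "real q * good_frac M a b \<le> 2 * real (?n a b)"
      using pos by (simp add: good_frac_eq field_simps)
    moreover have "0 \<le> 2 * real (?n a b)"
      by simp
    ultimately show ?thesis
      by (cases "(a, b) \<in> E") (simp_all del: mult_nonneg_nonneg)
  qed
  then have "real q * total M \<le> (\<Sum>a<l. \<Sum>b<r. 2 * real (?n a b))"
    unfolding total_def sum_distrib_left by (intro sum_mono) auto
  also have "\<dots> = 2 * (\<Sum>b<r. \<Sum>a<l. real (?n a b))"
    by (subst sum.swap) (simp add: sum_distrib_left)
  also have "(\<Sum>b<r. \<Sum>a<l. real (?n a b)) = (\<Sum>b<r. votes R l r q M b (\<tau> b))"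
    by (simp add: votes_def interv_sum_list_conv_sum_set_nat atLeast0LessThan)
  finally show ?thesis
    by simp
qed

text \<open>Two exchanges, each replacing an average by a maximum: the winning right labels get at
  least the votes of \<open>\<tau>\<close>, and, after swapping sums so that votes become gains, the
  best left label beats the average over the repetition.\<close>

lemma total_le_score:
  assumes "sound M"
  shows "total M \<le> 2 * real (score R l r (rounding R l r q M))"
proof (cases "q = 0")
  case True
  then have "l = 0"
    using \<sigma>_label[of 0] by auto
  then have "total M = 0"
    unfolding total_def by simp
  then show ?thesis
    by simp
next
  case False
  define ys where "ys = right_labels R l r q M"
  define xs where "xs = left_labels R l r q ys"
  let ?T = "\<lambda>a. spread q (consistent_labels R r q M a)"
  have "(\<Sum>b<r. votes R l r q M b (\<tau> b)) \<le> (\<Sum>b<r. votes R l r q M b (nth_default 0 ys b))"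
  proof (intro sum_mono)
    fix b
    assume "b \<in> {..<r}"
    then have "nth_default 0 ys b = argmax (votes R l r q M b) 1 [1..<Suc q]" "\<tau> b \<in> set [1..<Suc q]"
      using \<tau>_label[of b] by (auto simp: ys_def right_labels_def nth_default_nth)
    then show "votes R l r q M b (\<tau> b) \<le> votes R l r q M b (nth_default 0 ys b)"
      by (simp only: argmax_ge)
  qed
  also have "\<dots> = (\<Sum>a<l. \<Sum>i<q. gain R r ys a (?T a ! i))"
    unfolding votes_sum gain_sum
    by (subst sum.swap) (intro sum.cong refl sum.swap)
  also have "\<dots> \<le> (\<Sum>a<l. \<Sum>i<q. gain R r ys a (nth_default 0 xs a))"
  proof (intro sum_mono)
    fix a i
    assume "a \<in> {..<l}" "i \<in> {..<q}"
    then have "nth_default 0 xs a = argmax (gain R r ys a) 1 [1..<Suc q]" "?T a ! i \<in> set [1..<Suc q]"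
      using spread_nth_mem[OF assms, of a i] by (auto simp: xs_def left_labels_def nth_default_nth)
    then show "gain R r ys a (?T a ! i) \<le> gain R r ys a (nth_default 0 xs a)"
      by (simp only: argmax_ge)
  qed
  also have "\<dots> = q * score R l r (rounding R l r q M)"
    by (simp add: score_def rounding_def xs_def[symmetric] ys_def[symmetric] sum_distrib_left
        interv_sum_list_conv_sum_set_nat atLeast0LessThan)
  finally have "real (\<Sum>b<r. votes R l r q M b (\<tau> b)) \<le> real (q * score R l r (rounding R l r q M))"
    by (rule of_nat_mono)
  with total_le_votes[OF assms] have "real q * total M \<le> real q * (2 * real (score R l r (rounding R l r q M)))"
    by simp
  with False show ?thesis
    by simp
qed

subsection \<open>Progress by conditioning\<close>

text \<open>\<open>l\<close> times the logarithm of the geometric mean of the label set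
  sizes.\<close>

definition potential :: "nat list \<Rightarrow> real" where
  "potential M = (\<Sum>a<l. ln (card (lab M a)))"

lemma potential_nonneg: "sound M \<Longrightarrow> 0 \<le> potential M"
  unfolding potential_def using card_lab_pos[of M] by (intro sum_nonneg) (auto simp: Suc_le_eq)

lemma potential_le:
  assumes "sound M"
  shows "potential M \<le> real l * ln q"
proof -
  have "ln (card (lab M a)) \<le> ln q" if "a < l" for a
    using card_lab_pos[OF assms that] length_consistent_labels_le[of M a]
    by (intro ln_mono) (auto simp: card_lab)
  then have "potential M \<le> (\<Sum>a<l. ln q)"
    unfolding potential_def by (intro sum_mono) auto
  then show ?thesis
    by simp
qed

text \<open>Double counting of paths \<open>a\<close>, \<open>b\<close>, \<open>a'\<close>: summing
  the shrinking factors over all pairs gives at most \<open>D * total M / K\<close>, so some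
  \<open>a'\<close> has average factor below \<open>\<theta>\<close>. The inequality of arithmetic
  and geometric means turns this into a drop of the potential.\<close>

lemma exists_progress:
  fixes K D \<theta> :: real
  assumes "sound M" "0 < l" "0 < K" "0 < \<theta>"
    and codeg: "\<And>a a'. a < l \<Longrightarrow> a' < l \<Longrightarrow> K \<le> card {b. (a, b) \<in> E \<and> (a', b) \<in> E}"
    and deg: "\<And>b. b < r \<Longrightarrow> card {a. (a, b) \<in> E} \<le> D"
    and small: "D * total M < K * \<theta> * (real l)\<^sup>2"
  shows "\<exists>a'<l. potential (condition R r a' (\<sigma> a') M) \<le> potential M + l * ln \<theta>"
proof -
  define e where "e a b = (of_bool ((a, b) \<in> E) :: real)" for a b
  define w where "w a' a = card (lab (condition R r a' (\<sigma> a') M) a) / card (lab M a)" for a' a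
  have w: "K * w a' a \<le> (\<Sum>b<r. e a b * e a' b * good_frac M a b)" if "a' < l" "a < l" for a' a
  proof -
    let ?B = "{b. (a, b) \<in> E \<and> (a', b) \<in> E}"
    have B: "?B \<subseteq> {..<r}"
      using edges_subset by auto
    have "K * w a' a \<le> card ?B * w a' a"
      using that codeg by (intro mult_right_mono) (simp_all add: w_def)
    also have "\<dots> \<le> (\<Sum>b\<in>?B. good_frac M a b)"
      using card_lab_condition_le[OF assms(1) that] by (intro sum_bounded_below) (simp add: w_def)
    also have "\<dots> = (\<Sum>b\<in>?B. e a b * e a' b * good_frac M a b)"
      by (intro sum.cong) (auto simp: e_def)
    also have "\<dots> \<le> (\<Sum>b<r. e a b * e a' b * good_frac M a b)"
      using B by (intro sum_mono2) (auto simp: e_def good_frac_nonneg)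
    finally show ?thesis .
  qed
  have "(\<Sum>a'<l. K * (\<Sum>a<l. w a' a)) \<le> (\<Sum>a'<l. \<Sum>a<l. \<Sum>b<r. e a b * e a' b * good_frac M a b)"
    unfolding sum_distrib_left using w by (intro sum_mono) auto
  also have "\<dots> = (\<Sum>a<l. \<Sum>b<r. \<Sum>a'<l. e a b * e a' b * good_frac M a b)"
    by (subst sum.swap) (intro sum.cong refl sum.swap)
  also have "\<dots> = (\<Sum>a<l. \<Sum>b<r. (\<Sum>a'<l. e a' b) * (e a b * good_frac M a b))"
    unfolding sum_distrib_right by (intro sum.cong refl) (simp only: mult_ac)
  also have "\<dots> \<le> (\<Sum>a<l. \<Sum>b<r. D * (e a b * good_frac M a b))"
  proof (intro sum_mono mult_right_mono)
    fix b
    assume "b \<in> {..<r}"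
    have "(\<Sum>a'<l. e a' b) = card ({..<l} \<inter> {a. (a, b) \<in> E})"
      unfolding e_def by (subst sum_of_bool_eq) auto
    also have "{..<l} \<inter> {a. (a, b) \<in> E} = {a. (a, b) \<in> E}"
      using edges_subset by auto
    finally show "(\<Sum>a'<l. e a' b) \<le> D"
      using deg[of b] \<open>b \<in> {..<r}\<close> by simp
  qed (simp add: e_def good_frac_nonneg)
  also have "\<dots> = D * total M"
    by (simp only: total_def e_def sum_distrib_left)
  also have "\<dots> < (\<Sum>a'<l. K * \<theta> * l)"
    using small by (simp add: power2_eq_square mult_ac)
  finally have "\<exists>a'<l. K * (\<Sum>a<l. w a' a) < K * \<theta> * l"
    by (meson lessThan_iff not_less sum_mono)
  then obtain a' where a': "a' < l" "(\<Sum>a<l. w a' a) < \<theta> * l"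
    using \<open>0 < K\<close> by (auto simp: mult.assoc)
  let ?M' = "condition R r a' (\<sigma> a') M"
  \<comment> \<open>The tangent bound \<open>ln x \<le> x - 1\<close> at
    \<open>x = w a' a / \<theta>\<close> replaces concavity of the logarithm; after summation the
    linear terms add up to less than 0.\<close>
  have "ln (card (lab ?M' a)) - ln (card (lab M a)) \<le> ln \<theta> + w a' a / \<theta> - 1" if "a < l" for a
  proof -
    have pos: "0 < card (lab ?M' a)" "0 < card (lab M a)"
      using card_lab_pos assms(1) sound_condition[OF assms(1) a'(1)] that by blast+
    then have "0 < w a' a"
      by (simp add: w_def)
    have "ln (card (lab ?M' a)) - ln (card (lab M a)) = ln (w a' a)"
      using pos by (simp add: w_def ln_div)
    also have "\<dots> = ln \<theta> + ln (w a' a / \<theta>)"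
      using \<open>0 < w a' a\<close> \<open>0 < \<theta>\<close> by (simp add: ln_div)
    also have "\<dots> \<le> ln \<theta> + (w a' a / \<theta> - 1)"
      using \<open>0 < w a' a\<close> \<open>0 < \<theta>\<close> by (intro add_left_mono ln_le_minus_one) simp
    finally show ?thesis
      by simp
  qed
  then have "potential ?M' - potential M \<le> (\<Sum>a<l. ln \<theta> + w a' a / \<theta> - 1)"
    unfolding potential_def sum_subtractf[symmetric] by (intro sum_mono) simp
  also have "\<dots> = l * ln \<theta> + (\<Sum>a<l. w a' a) / \<theta> - l"
    by (simp add: sum.distrib sum_subtractf sum_divide_distrib)
  also have "\<dots> \<le> l * ln \<theta>"
    using a'(2) \<open>0 < \<theta>\<close> by (simp add: field_simps)
  finally show ?thesis
    using a'(1) by auto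
qed

text \<open>Induction on the rounds: either a good candidate has appeared, and \<open>refine\<close>
  keeps it, or every guess so far paid \<open>l * ln \<theta>\<close>. After \<open>k\<close>
  payments the potential would be at most \<open>l * ln (q * \<theta> ^ k)\<close>, which is
  negative.\<close>

lemma exists_good_state:
  fixes K D \<theta> :: real
  assumes "0 < l" "0 < K" "0 < \<theta>" "q * \<theta> ^ k < 1"
    and codeg: "\<And>a a'. a < l \<Longrightarrow> a' < l \<Longrightarrow> K \<le> card {b. (a, b) \<in> E \<and> (a', b) \<in> E}"
    and deg: "\<And>b. b < r \<Longrightarrow> card {a. (a, b) \<in> E} \<le> D"
  shows "\<exists>M\<in>set ((refine R l r q ^^ k) [[]]). sound M \<and> K * \<theta> * (real l)\<^sup>2 \<le> D * total M"
proof -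
  have "0 < q"
    using \<sigma>_label[OF assms(1)] by auto
  have "\<exists>M\<in>set ((refine R l r q ^^ j) [[]]). sound M \<and>
      (K * \<theta> * (real l)\<^sup>2 \<le> D * total M \<or> potential M \<le> l * (ln q + j * ln \<theta>))" for j
  proof (induction j)
    case 0
    have "sound []"
      by (simp add: sound_def nth_default_def)
    with potential_le[OF this] show ?case
      by simp
  next
    case (Suc j)
    let ?Ms = "(refine R l r q ^^ j) [[]]"
    from Suc obtain M where M: "M \<in> set ?Ms" "sound M"
      "K * \<theta> * (real l)\<^sup>2 \<le> D * total M \<or> potential M \<le> l * (ln q + j * ln \<theta>)"
      by blast
    show ?case
    proof (cases "K * \<theta> * (real l)\<^sup>2 \<le> D * total M")
      case True
      moreover have "M \<in> set (refine R l r q ?Ms)"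
        using M(1) by (simp add: set_refine)
      ultimately show ?thesis
        using M(2) by (intro bexI[of _ M]) auto
    next
      case False
      then obtain a where a: "a < l" "potential (condition R r a (\<sigma> a) M) \<le> potential M + l * ln \<theta>"
        using exists_progress[OF M(2) assms(1-3) codeg deg] by (auto simp: not_le)
      have "condition R r a (\<sigma> a) M \<in> set (refine R l r q ?Ms)"
        using M(1) a(1) \<sigma>_label[OF a(1)] unfolding set_refine by blast
      moreover have "potential (condition R r a (\<sigma> a) M) \<le> l * (ln q + Suc j * ln \<theta>)"
        using a(2) M(3) False by (simp add: algebra_simps)
      ultimately show ?thesis
        using sound_condition[OF M(2) a(1)] by (intro bexI[of _ "condition R r a (\<sigma> a) M"]) auto
    qed
  qed
  then obtain M where M: "M \<in> set ((refine R l r q ^^ k) [[]])" "sound M"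
    "K * \<theta> * (real l)\<^sup>2 \<le> D * total M \<or> potential M \<le> l * (ln q + k * ln \<theta>)"
    by blast
  have "ln q + k * ln \<theta> = ln (q * \<theta> ^ k)"
    using \<open>0 < q\<close> \<open>0 < \<theta>\<close> by (simp add: ln_mult ln_realpow)
  also have "\<dots> < 0"
    using assms(4) \<open>0 < q\<close> \<open>0 < \<theta>\<close> by (intro ln_less_zero) auto
  finally have "l * (ln q + k * ln \<theta>) < 0"
    using assms(1) by (simp add: mult_pos_neg)
  with M potential_nonneg[OF M(2)] show ?thesis
    by (intro bexI[of _ M]) auto
qed

text \<open>Which guesses were correct cannot be recognised, but scores can be compared, so the best
  candidate does at least as well as the good one.\<close>

lemma solve_score:
  fixes K D \<theta> :: real
  assumes "0 < l" "0 < K" "0 < \<theta>" "q * \<theta> ^ k < 1" "0 \<le> D"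
    and "\<And>a a'. a < l \<Longrightarrow> a' < l \<Longrightarrow> K \<le> card {b. (a, b) \<in> E \<and> (a', b) \<in> E}"
    and "\<And>b. b < r \<Longrightarrow> card {a. (a, b) \<in> E} \<le> D"
  shows "K * \<theta> * (real l)\<^sup>2 \<le> 2 * D * score R l r (solve k (l, r, q, R))"
proof -
  obtain M where M: "M \<in> set ((refine R l r q ^^ k) [[]])" "sound M"
    "K * \<theta> * (real l)\<^sup>2 \<le> D * total M"
    using exists_good_state[OF assms(1-4,6,7)] by blast
  have "score R l r (rounding R l r q M) \<le> score R l r (solve k (l, r, q, R))"
    unfolding solve_def prod.case using M(1) by (intro argmax_ge) auto
  with total_le_score[OF M(2)] have "total M \<le> 2 * score R l r (solve k (l, r, q, R))"
    by linarith
  then have "D * total M \<le> D * (2 * score R l r (solve k (l, r, q, R)))"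
    by (rule mult_left_mono) (rule assms(5))
  with M(3) show ?thesis
    by simp
qed

lemma score_eq:
  assumes "\<And>b. b < r \<Longrightarrow> nth_default 0 (snd \<phi>) b \<noteq> 0"
  shows "score R l r \<phi> =
    card {e \<in> E. proj_label R (fst e) (snd e) (nth_default 0 (fst \<phi>) (fst e)) = nth_default 0 (snd \<phi>) (snd e)}"
    (is "_ = card ?S")
proof -
  have "score R l r \<phi> = (\<Sum>a<l. \<Sum>b<r. of_bool (proj_label R a b (nth_default 0 (fst \<phi>) a) = nth_default 0 (snd \<phi>) b))"
    by (simp add: score_def gain_sum interv_sum_list_conv_sum_set_nat atLeast0LessThan del: sum_of_bool_eq)
  also have "\<dots> = (\<Sum>e\<in>{..<l} \<times> {..<r}. of_bool (proj_label R (fst e) (snd e) (nth_default 0 (fst \<phi>) (fst e)) =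
      nth_default 0 (snd \<phi>) (snd e)))"
    by (simp add: sum.cartesian_product case_prod_beta del: sum_of_bool_eq)
  also have "\<dots> = (\<Sum>e\<in>?S. 1)"
  proof (rule sum.mono_neutral_cong_right)
    show "?S \<subseteq> {..<l} \<times> {..<r}"
      using edges_subset by auto
    show "\<forall>e\<in>{..<l} \<times> {..<r} - ?S. of_bool (proj_label R (fst e) (snd e) (nth_default 0 (fst \<phi>) (fst e)) =
      nth_default 0 (snd \<phi>) (snd e)) = (0 :: nat)"
    proof
      fix e
      assume e: "e \<in> {..<l} \<times> {..<r} - ?S"
      show "of_bool (proj_label R (fst e) (snd e) (nth_default 0 (fst \<phi>) (fst e)) =
        nth_default 0 (snd \<phi>) (snd e)) = (0 :: nat)"
      proof (cases "e \<in> E")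
        case True
        with e show ?thesis
          by simp
      next
        case False
        with e show ?thesis
          using proj_non_edge[of "fst e" "snd e"] assms[of "snd e"] by auto
      qed
    qed
  qed auto
  finally show ?thesis
    by simp
qed

end

lemma solve_labels:
  assumes "solve k (l, r, q, R) = (xs, ys)" "0 < q"
  shows "length xs = l" "length ys = r" "set xs \<subseteq> {1..q}" "set ys \<subseteq> {1..q}"
proof -
  have "\<exists>M. (xs, ys) = rounding R l r q M"
    using argmax_mem[of "score R l r" "rounding R l r q []" "map (rounding R l r q) ((refine R l r q ^^ k) [[]])"]
      assms(1) by (auto simp: solve_def)
  then obtain M where M: "ys = right_labels R l r q M" "xs = left_labels R l r q ys"
    by (auto simp: rounding_def)
  have "argmax f 1 [1..<Suc q] \<in> {1..q}" for f :: "nat \<Rightarrow> nat"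
    using argmax_mem[of f 1 "[1..<Suc q]"] assms(2) by (auto simp del: upt_Suc)
  with M show "length xs = l" "length ys = r" "set xs \<subseteq> {1..q}" "set ys \<subseteq> {1..q}"
    by (auto simp: right_labels_def left_labels_def simp del: upt_Suc One_nat_def atLeastAtMost_iff)
qed

section \<open>Degrees and codegrees of random bipartite graphs\<close>

text \<open>The power is a product of independent factors, one per coin. For
  \<open>c = exp t\<close> this is the moment generating function of a binomial variable at
  \<open>t\<close>.\<close>

lemma nn_integral_power_card_Pi_pmf:
  fixes p c :: real
  assumes "finite I" "S \<subseteq> I" "0 \<le> p" "p \<le> 1" "0 \<le> c"
  shows "(\<integral>\<^sup>+f. ennreal (c ^ card {i \<in> S. f i}) \<partial>Pi_pmf I False (\<lambda>_. bernoulli_pmf p)) =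
    ennreal ((1 - p + p * c) ^ card S)"
proof -
  have S: "finite S"
    using assms(1,2) by (rule finite_subset[rotated])
  let ?g = "\<lambda>i y. if i \<in> S \<and> y then ennreal c else 1"
  have "ennreal (c ^ card {i \<in> S. f i}) = (\<Prod>i\<in>I. ?g i (f i))" for f
  proof -
    have "(\<Prod>i\<in>I. ?g i (f i)) = (\<Prod>i\<in>{i \<in> S. f i}. ennreal c)"
      using assms(1,2) by (intro prod.mono_neutral_cong_right) auto
    then show ?thesis
      using assms(5) by (simp add: ennreal_power)
  qed
  then have "(\<integral>\<^sup>+f. ennreal (c ^ card {i \<in> S. f i}) \<partial>Pi_pmf I False (\<lambda>_. bernoulli_pmf p)) =
      (\<Prod>i\<in>I. \<integral>\<^sup>+y. ?g i y \<partial>bernoulli_pmf p)"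
    by (simp only: nn_integral_prod_Pi_pmf[OF assms(1), where f = ?g])
  also have "\<dots> = (\<Prod>i\<in>I. if i \<in> S then ennreal (1 - p + p * c) else 1)"
    using assms(3-5) by (intro prod.cong refl)
      (auto simp: ennreal_mult[symmetric] ennreal_plus[symmetric] algebra_simps simp del: ennreal_plus)
  also have "\<dots> = (\<Prod>i\<in>S. ennreal (1 - p + p * c))"
    using assms(1,2) by (intro prod.mono_neutral_cong_right) auto
  also have "\<dots> = ennreal ((1 - p + p * c) ^ card S)"
    using assms(3-5) by (simp add: ennreal_power del: ennreal_plus)
  finally show ?thesis .
qed

text \<open>Given the row of \<open>a\<close>, the codegree is binomial over the neighbours of
  \<open>a\<close>. Integrating out the other rows leaves a power of the degree of \<open>a\<close>,
  to which the same formula applies again.\<close>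

lemma nn_integral_power_codegree:
  fixes p c :: real and a a' k l :: nat
  assumes "a < k" "a' < k" "a \<noteq> a'" "0 \<le> p" "p \<le> 1" "0 \<le> c"
  shows "(\<integral>\<^sup>+f. ennreal (c ^ card {b. b < l \<and> f (a, b) \<and> f (a', b)})
      \<partial>Pi_pmf ({..<k} \<times> {..<l}) False (\<lambda>_. bernoulli_pmf p)) =
    ennreal ((1 - p + p * (1 - p + p * c)) ^ l)"
proof -
  define A where "A = {a} \<times> {..<l}"
  define B where "B = ({..<k} - {a}) \<times> {..<l}"
  have AB: "{..<k} \<times> {..<l} = A \<union> B" "finite A" "finite B" "A \<inter> B = {}"
    using assms(1) by (auto simp: A_def B_def)
  have inner: "(\<integral>\<^sup>+g. ennreal (c ^ card {b. b < l \<and> f (a, b) \<and> g (a', b)}) \<partial>Pi_pmf B False (\<lambda>_. bernoulli_pmf p)) =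
      ennreal ((1 - p + p * c) ^ card {i \<in> A. f i})" for f
  proof -
    let ?S = "Pair a' ` {b. b < l \<and> f (a, b)}"
    have "card {b. b < l \<and> f (a, b) \<and> g (a', b)} = card {i \<in> ?S. g i}" for g
    proof -
      have "{i \<in> ?S. g i} = Pair a' ` {b. b < l \<and> f (a, b) \<and> g (a', b)}"
        by auto
      then show ?thesis
        by (simp add: card_image inj_on_def)
    qed
    moreover have "card {i \<in> A. f i} = card ?S"
    proof -
      have "{i \<in> A. f i} = Pair a ` {b. b < l \<and> f (a, b)}"
        by (auto simp: A_def)
      then show ?thesis
        by (simp add: card_image inj_on_def)
    qed
    moreover have "?S \<subseteq> B"
      using assms(2,3) by (auto simp: B_def)
    ultimately show ?thesis
      using nn_integral_power_card_Pi_pmf[of B ?S p c] AB(3) assms(4-6) by simp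
  qed
  have "(\<integral>\<^sup>+f. ennreal (c ^ card {b. b < l \<and> f (a, b) \<and> f (a', b)})
      \<partial>Pi_pmf ({..<k} \<times> {..<l}) False (\<lambda>_. bernoulli_pmf p)) =
    (\<integral>\<^sup>+f. \<integral>\<^sup>+g. ennreal (c ^ card {b. b < l \<and> f (a, b) \<and> g (a', b)}) \<partial>Pi_pmf B False (\<lambda>_. bernoulli_pmf p)
      \<partial>Pi_pmf A False (\<lambda>_. bernoulli_pmf p))"
    unfolding AB(1) Pi_pmf_union[OF AB(2-4)] nn_integral_map_pmf nn_integral_pair_pmf'
    using assms(3) by (intro nn_integral_cong arg_cong[where f = "\<lambda>S. ennreal (c ^ card S)"])
      (auto simp: A_def)
  also have "\<dots> = ennreal ((1 - p + p * (1 - p + p * c)) ^ card A)"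
    unfolding inner using AB(2) assms(4-6) by (intro nn_integral_power_card_Pi_pmf) auto
  finally show ?thesis
    by (simp add: A_def)
qed

text \<open>Markov's inequality for \<open>u\<close> with threshold \<open>1 / t\<close>.\<close>

lemma prob_le_of_nn_integral_le:
  fixes u :: "'a \<Rightarrow> real"
  assumes "(\<integral>\<^sup>+x. ennreal (u x) \<partial>measure_pmf Q) \<le> ennreal B" "0 \<le> B" "0 \<le> t"
    and "\<And>x. x \<in> S \<Longrightarrow> 1 \<le> t * u x" "\<And>x. 0 \<le> u x"
  shows "measure_pmf.prob Q S \<le> t * B"
proof -
  have "emeasure Q S = (\<integral>\<^sup>+x. indicator S x \<partial>measure_pmf Q)"
    by simp
  also have "\<dots> \<le> (\<integral>\<^sup>+x. ennreal t * ennreal (u x) \<partial>measure_pmf Q)"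
    using assms(3-5) by (intro nn_integral_mono) (auto simp: indicator_def ennreal_mult[symmetric])
  also have "\<dots> \<le> ennreal t * ennreal B"
    using assms(1) by (simp add: nn_integral_cmult mult_left_mono)
  also have "\<dots> = ennreal (t * B)"
    using assms(2,3) by (simp add: ennreal_mult)
  finally show ?thesis
    using assms(2,3) by (simp add: measure_pmf.emeasure_eq_measure)
qed

lemma one_plus_power_le_exp:
  fixes x :: real
  assumes "0 \<le> 1 + x"
  shows "(1 + x) ^ n \<le> exp (n * x)"
proof -
  have "(1 + x) ^ n \<le> exp x ^ n"
    using assms by (intro power_mono exp_ge_add_one_self) auto
  then show ?thesis
    by (simp add: exp_of_nat_mult)
qed

text \<open>Chernoff bound with base \<open>exp 1\<close>: as \<open>exp 1 - 1 \<le> 2\<close>, the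
  moment is at most \<open>exp (2 * (p * k))\<close>, against \<open>exp (3 * p * k)\<close> at the
  threshold.\<close>

lemma prob_degree_large:
  fixes p :: real
  assumes "b < l" "0 \<le> p" "p \<le> 1"
  shows "measure_pmf.prob (random_bipartite k l p) {E. 3 * p * k < card {a. a < k \<and> (a, b) \<in> E}} \<le>
    exp (- (p * k))"
proof -
  let ?Q = "Pi_pmf ({..<k} \<times> {..<l}) False (\<lambda>_. bernoulli_pmf p)"
  let ?u = "\<lambda>f. exp 1 ^ card {a. a < k \<and> f (a, b)} :: real"
  let ?S = "(\<lambda>a. (a, b)) ` {..<k}"
  have e: "exp 1 \<le> (3 :: real)"
    by (rule exp_le)
  have "card {a. a < k \<and> f (a, b)} = card {i \<in> ?S. f i}" for f
  proof -
    have "{i \<in> ?S. f i} = (\<lambda>a. (a, b)) ` {a. a < k \<and> f (a, b)}"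
      by auto
    then show ?thesis
      by (simp add: card_image inj_on_def)
  qed
  moreover have "card ?S = k"
    by (simp add: card_image inj_on_def)
  moreover have "?S \<subseteq> {..<k} \<times> {..<l}"
    using assms(1) by auto
  ultimately have "(\<integral>\<^sup>+f. ennreal (?u f) \<partial>?Q) = ennreal ((1 - p + p * exp 1) ^ k)"
    using nn_integral_power_card_Pi_pmf[of "{..<k} \<times> {..<l}" ?S p "exp 1"] assms(2,3) by simp
  also have "(1 - p + p * exp 1) ^ k = (1 + p * (exp 1 - 1)) ^ k"
    by (simp add: algebra_simps)
  also have "\<dots> \<le> exp (k * (p * (exp 1 - 1)))"
    using assms(2) by (intro one_plus_power_le_exp) (simp add: add_nonneg_nonneg)
  also have "\<dots> \<le> exp (2 * (p * k))"
  proof -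
    have "real k * p * (exp 1 - 1) \<le> real k * p * 2"
      using e assms(2) by (intro mult_left_mono) auto
    then show ?thesis
      by (simp add: mult_ac)
  qed
  finally have "(\<integral>\<^sup>+f. ennreal (?u f) \<partial>?Q) \<le> ennreal (exp (2 * (p * k)))"
    by (simp add: ennreal_leI)
  then have "measure_pmf.prob ?Q {f. 3 * p * k < card {a. a < k \<and> f (a, b)}} \<le>
      exp (- (3 * p * k)) * exp (2 * (p * k))"
    by (rule prob_le_of_nn_integral_le) (auto simp: exp_of_nat_mult[symmetric] exp_add[symmetric])
  also have "\<dots> = exp (- (p * k))"
    by (simp add: exp_add[symmetric])
  finally show ?thesis
    by (simp add: random_bipartite_def vimage_def)
qed

text \<open>Chernoff bound for the lower tail with base \<open>exp (- 1)\<close>, which is at most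
  1/2. The moment is at most \<open>exp (- (p\<^sup>2 * l / 2))\<close>, and the threshold gives
  back half of this exponent.\<close>

lemma prob_codegree_small:
  fixes p :: real
  assumes "a < k" "a' < k" "a \<noteq> a'" "0 \<le> p" "p \<le> 1"
  shows "measure_pmf.prob (random_bipartite k l p)
    {E. card {b. b < l \<and> (a, b) \<in> E \<and> (a', b) \<in> E} < p\<^sup>2 * l / 4} \<le> exp (- (p\<^sup>2 * l / 4))"
proof -
  let ?Q = "Pi_pmf ({..<k} \<times> {..<l}) False (\<lambda>_. bernoulli_pmf p)"
  let ?u = "\<lambda>f. exp (- 1) ^ card {b. b < l \<and> f (a, b) \<and> f (a', b)} :: real"
  have e: "exp (- 1) \<le> (1 / 2 :: real)"
    using exp_ge_add_one_self[of 1] by (simp add: exp_minus field_simps)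
  have p2: "0 \<le> p\<^sup>2" "p\<^sup>2 \<le> 1"
    using assms(4,5) by (simp_all add: power_le_one)
  have "(\<integral>\<^sup>+f. ennreal (?u f) \<partial>?Q) = ennreal ((1 - p + p * (1 - p + p * exp (- 1))) ^ l)"
    using assms by (intro nn_integral_power_codegree) auto
  also have "1 - p + p * (1 - p + p * exp (- 1)) = 1 + p\<^sup>2 * (exp (- 1) - 1)"
    by (simp add: algebra_simps power2_eq_square)
  also have "(1 + p\<^sup>2 * (exp (- 1) - 1)) ^ l \<le> exp (l * (p\<^sup>2 * (exp (- 1) - 1)))"
  proof (rule one_plus_power_le_exp)
    have "p\<^sup>2 * (1 - exp (- 1)) \<le> 1 * 1"
      using p2 by (intro mult_mono) auto
    then show "0 \<le> 1 + p\<^sup>2 * (exp (- 1) - 1)"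
      by (simp add: algebra_simps)
  qed
  also have "\<dots> \<le> exp (- (p\<^sup>2 * l / 2))"
  proof -
    have "real l * p\<^sup>2 * (exp (- 1) - 1) \<le> real l * p\<^sup>2 * (- 1 / 2)"
      using e by (intro mult_left_mono) auto
    then show ?thesis
      by (simp add: mult_ac)
  qed
  finally have "(\<integral>\<^sup>+f. ennreal (?u f) \<partial>?Q) \<le> ennreal (exp (- (p\<^sup>2 * l / 2)))"
    by (simp add: ennreal_leI)
  then have "measure_pmf.prob ?Q {f. card {b. b < l \<and> f (a, b) \<and> f (a', b)} < p\<^sup>2 * l / 4} \<le>
      exp (p\<^sup>2 * l / 4) * exp (- (p\<^sup>2 * l / 2))"
    by (rule prob_le_of_nn_integral_le) (auto simp: exp_of_nat_mult[symmetric] exp_add[symmetric])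
  also have "\<dots> = exp (- (p\<^sup>2 * l / 4))"
    by (simp add: exp_add[symmetric])
  finally show ?thesis
    by (simp add: random_bipartite_def vimage_def)
qed

definition well_spread :: "nat \<Rightarrow> real \<Rightarrow> (nat \<times> nat) set \<Rightarrow> bool" where
  "well_spread m p E \<longleftrightarrow>
    (\<forall>a<m. \<forall>a'<m. a \<noteq> a' \<longrightarrow> (p :: real)\<^sup>2 * real m / 4 \<le> card {b. b < m \<and> (a, b) \<in> E \<and> (a', b) \<in> E}) \<and>
    (\<forall>b<m. card {a. a < m \<and> (a, b) \<in> E} \<le> 3 * (p :: real) * real m)"

text \<open>The assumption on \<open>p\<close> yields \<open>50 * ln n \<le> p\<^sup>2 * m\<close>,
  so a codegree fails with probability at most \<open>1 / n ^ 3\<close> and a degree with at most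
  \<open>1 / n ^ 2\<close>. The union bounds over pairs and over right vertices cost at most
  \<open>1 / n\<close> each.\<close>

lemma prob_well_spread:
  fixes p :: real and n :: nat
  assumes "n > 0" "even n" "10 * sqrt (ln n / n) \<le> p" "p \<le> 1"
  shows "measure_pmf.prob (random_bipartite (n div 2) (n div 2) p) {E. well_spread (n div 2) p E} \<ge> 1 - 2 / n"
proof -
  define m where "m = n div 2"
  have n: "real n = 2 * real m" "0 < m" "2 \<le> n"
    using assms(1,2) by (auto simp: m_def elim!: evenE)
  have "0 \<le> ln (real n) / real n"
    using n by simp
  then have p0: "0 \<le> p"
    using assms(3) by (smt (verit) real_sqrt_ge_zero)
  have "100 * (ln n / n) = (10 * sqrt (ln n / n))\<^sup>2"
    using \<open>0 \<le> ln (real n) / real n\<close> by (simp add: power_mult_distrib)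
  also have "\<dots> \<le> p\<^sup>2"
    using assms(3) \<open>0 \<le> ln (real n) / real n\<close> by (intro power_mono) auto
  finally have p2m: "50 * ln n \<le> p\<^sup>2 * m"
    using n by (simp add: field_simps)
  have "p\<^sup>2 * m \<le> p * m"
    using p0 assms(4) by (intro mult_right_mono) (simp_all add: power2_eq_square mult_left_le)
  then have pm: "50 * ln n \<le> p * m"
    using p2m by simp
  have ln0: "0 \<le> ln (real n)"
    using n by simp
  let ?Q = "random_bipartite m m p"
  let ?C = "\<lambda>a a'. {E. card {b. b < m \<and> (a, b) \<in> E \<and> (a', b) \<in> E} < p\<^sup>2 * m / 4}"
  let ?D = "\<lambda>b. {E. 3 * p * m < card {a. a < m \<and> (a, b) \<in> E}}"
  let ?I = "{i \<in> {..<m} \<times> {..<m}. fst i \<noteq> snd i}"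
  let ?bad = "(\<Union>i\<in>?I. ?C (fst i) (snd i)) \<union> (\<Union>b\<in>{..<m}. ?D b)"
  have "measure_pmf.prob ?Q (\<Union>i\<in>?I. ?C (fst i) (snd i)) \<le> (\<Sum>i\<in>?I. measure_pmf.prob ?Q (?C (fst i) (snd i)))"
    by (intro measure_pmf.finite_measure_subadditive_finite) auto
  also have "\<dots> \<le> (\<Sum>i\<in>?I. exp (- 3 * ln n))"
  proof (intro sum_mono)
    fix i
    assume "i \<in> ?I"
    then have "measure_pmf.prob ?Q (?C (fst i) (snd i)) \<le> exp (- (p\<^sup>2 * m / 4))"
      using p0 assms(4) by (intro prob_codegree_small) auto
    also have "\<dots> \<le> exp (- 3 * ln n)"
      using p2m ln0 by simp
    finally show "measure_pmf.prob ?Q (?C (fst i) (snd i)) \<le> exp (- 3 * ln n)" .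
  qed
  also have "\<dots> \<le> (\<Sum>i\<in>{..<m} \<times> {..<m}. exp (- 3 * ln n))"
    by (intro sum_mono2) auto
  also have "\<dots> = (real m * real m) / real n ^ 3"
  proof -
    have "exp (- 3 * ln (real n)) = 1 / real n ^ 3"
      using n by (simp add: exp_minus exp_of_nat_mult[of 3, simplified] field_simps)
    then show ?thesis
      by simp
  qed
  also have "\<dots> \<le> 1 / n"
    using n by (simp add: field_simps power3_eq_cube)
  finally have C: "measure_pmf.prob ?Q (\<Union>i\<in>?I. ?C (fst i) (snd i)) \<le> 1 / n" .
  have "measure_pmf.prob ?Q (\<Union>b\<in>{..<m}. ?D b) \<le> (\<Sum>b\<in>{..<m}. measure_pmf.prob ?Q (?D b))"
    by (intro measure_pmf.finite_measure_subadditive_finite) auto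
  also have "\<dots> \<le> (\<Sum>b\<in>{..<m}. exp (- 2 * ln n))"
  proof (intro sum_mono)
    fix b
    assume "b \<in> {..<m}"
    then have "measure_pmf.prob ?Q (?D b) \<le> exp (- (p * m))"
      using p0 assms(4) by (intro prob_degree_large) auto
    also have "\<dots> \<le> exp (- 2 * ln n)"
      using pm ln0 by simp
    finally show "measure_pmf.prob ?Q (?D b) \<le> exp (- 2 * ln n)" .
  qed
  also have "\<dots> = real m / real n ^ 2"
  proof -
    have "exp (- 2 * ln (real n)) = 1 / real n ^ 2"
      using n by (simp add: exp_minus exp_of_nat_mult[of 2, simplified] field_simps)
    then show ?thesis
      by simp
  qed
  also have "\<dots> \<le> 1 / n"
    using n by (simp add: field_simps power2_eq_square)
  finally have D: "measure_pmf.prob ?Q (\<Union>b\<in>{..<m}. ?D b) \<le> 1 / n" .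
  have "measure_pmf.prob ?Q ?bad \<le> 2 / n"
    using measure_Un_le[of "\<Union>i\<in>?I. ?C (fst i) (snd i)" ?Q "\<Union>b\<in>{..<m}. ?D b"] C D
    by simp
  moreover have "{E. well_spread m p E} = UNIV - ?bad"
    unfolding well_spread_def by (fastforce simp: not_less not_le)
  ultimately show ?thesis
    using measure_pmf.prob_compl[of ?bad ?Q] by (simp add: m_def)
qed

section \<open>Running the algorithm on games\<close>

definition game_rows :: "projection_game \<Rightarrow> nat list option list list" where
  "game_rows G = map (\<lambda>a. map (\<lambda>b.
    if (a, b) \<in> edges G then Some (map (projection G (a, b)) [1..<Suc (labels G)]) else None)
    [0..<right_count G]) [0..<left_count G]"

lemma encode_list_map: "encode_list f (map g xs) = encode_list (\<lambda>x. f (g x)) xs"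
  by (induction xs) auto

text \<open>Thanks to this coincidence of encodings, a program for a function on tuples runs
  directly on encoded games.\<close>

lemma encode_game_eq: "encode_game G = enc (left_count G, right_count G, labels G, game_rows G)"
proof -
  have "encode_entry G (a, b) =
      enc (if (a, b) \<in> edges G then Some (map (projection G (a, b)) [1..<Suc (labels G)]) else None)" for a b
    by (simp add: encode_entry_def enc_list_def enc_nat_def[abs_def] encode_list_map del: upt_Suc)
  then show ?thesis
    by (simp add: encode_game_def game_rows_def enc_list_def enc_nat_def encode_list_map del: upt_Suc)
qed

lemma encode_assignment_eq:
  assumes "length xs = left_count G" "length ys = right_count G"
  shows "encode_assignment G (\<lambda>v. case v of Inl a \<Rightarrow> nth_default 0 xs a | Inr b \<Rightarrow> nth_default 0 ys b) = enc (xs, ys)"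
proof -
  have "map (nth_default 0 zs) [0..<length zs] = zs" for zs :: "nat list"
    by (rule nth_equalityI) (simp_all add: nth_default_nth)
  then have "encode_list (\<lambda>i. encode_nat (nth_default 0 zs i)) [0..<length zs] = enc zs" for zs
    using encode_list_map[of encode_nat "nth_default 0 zs" "[0..<length zs]"]
    by (simp add: enc_list_def enc_nat_def[abs_def])
  from this[of xs] this[of ys] show ?thesis
    by (simp add: encode_assignment_def assms)
qed

lemma proj_label_game_rows:
  assumes "a < left_count G" "b < right_count G" "x \<in> {1..labels G} \<or> (a, b) \<notin> edges G"
  shows "proj_label (game_rows G) a b x = (if (a, b) \<in> edges G then projection G (a, b) x else 0)"
  using assms by (auto simp: proj_label_def game_rows_def nth_default_nth simp del: upt_Suc)

lemma satisfied_game_of_satisfying: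
  assumes "valid_game G" "is_assignment G \<psi>" "\<forall>e\<in>edges G. satisfies G \<psi> e"
  shows "satisfied_game (game_rows G) (left_count G) (right_count G) (labels G) (edges G)
    (\<psi> \<circ> Inl) (\<psi> \<circ> Inr)"
proof
  show sub: "edges G \<subseteq> {..<left_count G} \<times> {..<right_count G}"
    using assms(1) by (simp add: valid_game_def)
  show left: "(\<psi> \<circ> Inl) a \<in> {1..labels G}" if "a < left_count G" for a
    using assms(2) that by (auto simp: is_assignment_def image_subset_iff simp del: atLeastAtMost_iff)
  show "(\<psi> \<circ> Inr) b \<in> {1..labels G}" if "b < right_count G" for b
    using assms(2) that by (auto simp: is_assignment_def image_subset_iff simp del: atLeastAtMost_iff)
  show "proj_label (game_rows G) a b x = 0"
    if "a < left_count G" "b < right_count G" "(a, b) \<notin> edges G" for a b x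
    using that by (simp add: proj_label_game_rows)
  fix a b
  assume e: "(a, b) \<in> edges G"
  then have ab: "a < left_count G" "b < right_count G"
    using sub by auto
  show "proj_label (game_rows G) a b x \<in> {1..labels G}" if "x \<in> {1..labels G}" for x
  proof -
    have "projection G (a, b) x \<in> {1..labels G}"
      using assms(1) e that unfolding valid_game_def by blast
    then show ?thesis
      using e ab that by (simp add: proj_label_game_rows)
  qed
  show "proj_label (game_rows G) a b ((\<psi> \<circ> Inl) a) = (\<psi> \<circ> Inr) b"
  proof -
    have "satisfies G \<psi> (a, b)"
      using assms(3) e by blast
    then show ?thesis
      using e ab left[OF ab(1)] by (simp add: proj_label_game_rows satisfies_def)
  qed
qed

text \<open>One factor \<open>D\<close> stems from the progress argument, the other from bounding
  the number of edges by \<open>right_count G * D\<close> when the score is turned into a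
  fraction.\<close>

lemma assignment_value_solve:
  fixes K D \<theta> :: real
  assumes "valid_game G" "satisfiable G" "0 < left_count G"
    and "solve k (left_count G, right_count G, labels G, game_rows G) = (xs, ys)"
    and "0 < K" "0 < D" "0 < \<theta>" "labels G * \<theta> ^ k < 1"
    and codeg: "\<And>a a'. a < left_count G \<Longrightarrow> a' < left_count G \<Longrightarrow>
      K \<le> card {b. (a, b) \<in> edges G \<and> (a', b) \<in> edges G}"
    and deg: "\<And>b. b < right_count G \<Longrightarrow> card {a. (a, b) \<in> edges G} \<le> D"
  defines "\<phi> \<equiv> \<lambda>v. case v of Inl a \<Rightarrow> nth_default 0 xs a | Inr b \<Rightarrow> nth_default 0 ys b"
  shows "is_assignment G \<phi>" "encode_assignment G \<phi> = enc (xs, ys)"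
    "K * \<theta> * (real (left_count G))\<^sup>2 \<le> 2 * D\<^sup>2 * right_count G * assignment_value G \<phi>"
proof -
  let ?l = "left_count G" and ?r = "right_count G" and ?q = "labels G"
  obtain \<psi> where \<psi>: "is_assignment G \<psi>" "\<forall>e\<in>edges G. satisfies G \<psi> e"
    using assms(2) by (auto simp: satisfiable_def)
  interpret satisfied_game "game_rows G" ?l ?r ?q "edges G" "\<psi> \<circ> Inl" "\<psi> \<circ> Inr"
    by (rule satisfied_game_of_satisfying) (use assms \<psi> in auto)
  have "0 < ?q"
    using \<sigma>_label[OF assms(3)] by auto
  note xy = solve_labels[OF assms(4) this]
  have xs: "nth_default 0 xs a \<in> {1..?q}" if "a < ?l" for a
    using xy(1,3) that by (metis nth_default_nth nth_mem subsetD)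
  have ys: "nth_default 0 ys b \<in> {1..?q}" if "b < ?r" for b
    using xy(2,4) that by (metis nth_default_nth nth_mem subsetD)
  show "is_assignment G \<phi>"
    using xs ys by (auto simp: is_assignment_def \<phi>_def image_subset_iff simp del: atLeastAtMost_iff)
  show "encode_assignment G \<phi> = enc (xs, ys)"
    unfolding \<phi>_def by (rule encode_assignment_eq) (rule xy)+
  have "score (game_rows G) ?l ?r (xs, ys) = card {e \<in> edges G.
      proj_label (game_rows G) (fst e) (snd e) (nth_default 0 xs (fst e)) = nth_default 0 ys (snd e)}"
    using score_eq[of "(xs, ys)"] ys by fastforce
  also have "{e \<in> edges G. proj_label (game_rows G) (fst e) (snd e) (nth_default 0 xs (fst e)) = nth_default 0 ys (snd e)} =
      {e \<in> edges G. satisfies G \<phi> e}"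
    using edges_subset xs by (auto simp: satisfies_def \<phi>_def proj_label_game_rows simp del: atLeastAtMost_iff)
  finally have score: "K * \<theta> * (real ?l)\<^sup>2 \<le> 2 * D * card {e \<in> edges G. satisfies G \<phi> e}"
    using solve_score[OF assms(3,5,7,8) less_imp_le[OF assms(6)] codeg deg] by (simp only: assms(4))
  have "edges G = (\<Union>b<?r. (\<lambda>a. (a, b)) ` {a. (a, b) \<in> edges G})"
    using edges_subset by auto
  then have "card (edges G) = card (\<Union>b<?r. (\<lambda>a. (a, b)) ` {a. (a, b) \<in> edges G})"
    by (rule arg_cong)
  also have "\<dots> \<le> (\<Sum>b<?r. card ((\<lambda>a. (a, b)) ` {a. (a, b) \<in> edges G}))"
    by (rule card_UN_le) simp
  also have "\<dots> = (\<Sum>b<?r. card {a. (a, b) \<in> edges G})"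
    by (intro sum.cong refl card_image) (simp add: inj_on_def)
  finally have "real (card (edges G)) \<le> (\<Sum>b<?r. real (card {a. (a, b) \<in> edges G}))"
    by (metis of_nat_le_iff of_nat_sum)
  also have "\<dots> \<le> (\<Sum>b<?r. D)"
    using deg by (intro sum_mono) auto
  finally have edges: "real (card (edges G)) \<le> ?r * D"
    by simp
  \<comment> \<open>A positive score excludes an empty edge set, for which the value would be a
    division by 0.\<close>
  have "0 < K * \<theta> * (real ?l)\<^sup>2"
    using assms by simp
  with score have "edges G \<noteq> {}"
    by (intro notI) auto
  then have "card {e \<in> edges G. satisfies G \<phi> e} = card (edges G) * assignment_value G \<phi>"
    using finite_edges by (simp add: assignment_value_def)
  also have "\<dots> \<le> ?r * D * assignment_value G \<phi>"
    using edges by (intro mult_right_mono) (simp_all add: assignment_value_def)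
  finally have "2 * D * card {e \<in> edges G. satisfies G \<phi> e} \<le> 2 * D * (?r * D * assignment_value G \<phi>)"
    using \<open>0 < D\<close> by (intro mult_left_mono) auto
  with score show "K * \<theta> * (real ?l)\<^sup>2 \<le> 2 * D\<^sup>2 * ?r * assignment_value G \<phi>"
    by (simp add: power2_eq_square mult_ac)
qed

lemma solve_on_well_spread:
  fixes p \<gamma> :: real and k :: nat
  assumes "0 < \<gamma>" "1 \<le> k * \<gamma>" "0 < p" "2 \<le> m"
    and "well_spread m p (edges G)"
    and G: "valid_game G" "left_count G = m" "right_count G = m" "satisfiable G"
    and "solve k (m, m, labels G, game_rows G) = (xs, ys)"
  defines "\<phi> \<equiv> \<lambda>v. case v of Inl a \<Rightarrow> nth_default 0 xs a | Inr b \<Rightarrow> nth_default 0 ys b"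
  shows "is_assignment G \<phi>" "encode_assignment G \<phi> = enc (xs, ys)"
    "assignment_value G \<phi> \<ge> 1 / 72 * real (game_size G) powr (- \<gamma>)"
proof -
  let ?E = "edges G" and ?q = "labels G"
  define \<theta> where "\<theta> = real (game_size G) powr (- \<gamma>)"
  define K where "K = p\<^sup>2 * m / 4"
  define D where "D = 3 * p * m"
  have sub: "?E \<subseteq> {..<m} \<times> {..<m}"
    using G by (simp add: valid_game_def)
  obtain \<psi> where "is_assignment G \<psi>"
    using G(4) by (auto simp: satisfiable_def)
  then have "\<psi> (Inl 0) \<in> {1..?q}"
    using assms(4) G(2) by (auto simp: is_assignment_def image_subset_iff simp del: atLeastAtMost_iff)
  then have "0 < ?q"
    by auto
  have N: "real (game_size G) = 2 * real m * real ?q"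
    by (simp add: game_size_def vertex_count_def G)
  have N1: "1 < real (game_size G)" "real ?q < real (game_size G)"
  proof -
    have "2 * 1 \<le> m * ?q" "2 * ?q \<le> m * ?q"
      using assms(4) \<open>0 < ?q\<close> by (intro mult_mono; simp)+
    then have "2 \<le> real m * real ?q" "2 * real ?q \<le> real m * real ?q"
      by (metis of_nat_mult of_nat_le_iff of_nat_numeral mult_1_right)+
    then show "1 < real (game_size G)" "real ?q < real (game_size G)"
      using \<open>0 < ?q\<close> unfolding N by linarith+
  qed
  \<comment> \<open>Since \<open>k * \<gamma> \<ge> 1\<close>, the power is at most
    \<open>1 / N\<close> with \<open>N\<close> the size of the game, and
    \<open>q < N\<close>.\<close>
  have "\<theta> ^ k = real (game_size G) powr (- \<gamma> * k)"
  proof -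
    have "0 < \<theta>"
      using N1 by (simp add: \<theta>_def)
    then have "\<theta> ^ k = \<theta> powr k"
      by (rule powr_realpow[symmetric])
    then show ?thesis
      by (simp add: \<theta>_def powr_powr)
  qed
  also have "\<dots> \<le> real (game_size G) powr (- 1)"
    using N1 assms(2) by (intro powr_mono) (auto simp: mult.commute)
  also have "\<dots> = 1 / real (game_size G)"
    using N1 by (simp add: powr_minus_divide)
  finally have "?q * \<theta> ^ k \<le> ?q * (1 / real (game_size G))"
    by (rule mult_left_mono) simp
  also have "\<dots> < 1"
    using N1 by simp
  finally have q: "?q * \<theta> ^ k < 1" .
  have codeg': "K \<le> card {b. (a, b) \<in> ?E \<and> (a', b) \<in> ?E}" if "a < m" "a' < m" "a \<noteq> a'" for a a'
  proof -
    have "{b. b < m \<and> (a, b) \<in> ?E \<and> (a', b) \<in> ?E} = {b. (a, b) \<in> ?E \<and> (a', b) \<in> ?E}"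
      using sub by auto
    moreover have "K \<le> card {b. b < m \<and> (a, b) \<in> ?E \<and> (a', b) \<in> ?E}"
      using assms(5) that unfolding well_spread_def K_def by blast
    ultimately show ?thesis
      by (simp only:)
  qed
  have codeg: "K \<le> card {b. (a, b) \<in> ?E \<and> (a', b) \<in> ?E}" if "a < m" "a' < m" for a a'
  proof (cases "a = a'")
    case True
    \<comment> \<open>The codegree of \<open>a\<close> with itself is its degree, which is at least
      its codegree with any other left vertex; \<open>2 \<le> m\<close> provides one.\<close>
    define a'' where "a'' = (if a = 0 then 1 else 0 :: nat)"
    have "K \<le> card {b. (a, b) \<in> ?E \<and> (a'', b) \<in> ?E}"
      using codeg'[of a a''] assms(4) that by (simp add: a''_def split: if_splits)
    also have "card {b. (a, b) \<in> ?E \<and> (a'', b) \<in> ?E} \<le> card {b. (a, b) \<in> ?E \<and> (a', b) \<in> ?E}"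
    proof (rule card_mono)
      show "finite {b. (a, b) \<in> ?E \<and> (a', b) \<in> ?E}"
        by (rule finite_subset[of _ "{..<m}"]) (use sub in auto)
    qed (use True in auto)
    finally show ?thesis
      by simp
  qed (use codeg' that in auto)
  have deg: "card {a. (a, b) \<in> ?E} \<le> D" if "b < m" for b
  proof -
    have "{a. a < m \<and> (a, b) \<in> ?E} = {a. (a, b) \<in> ?E}"
      using sub by auto
    moreover have "card {a. a < m \<and> (a, b) \<in> ?E} \<le> D"
      using assms(5) that unfolding well_spread_def D_def by blast
    ultimately show ?thesis
      by (simp only:)
  qed
  have pos: "0 < K" "0 < D" "0 < \<theta>" "0 < left_count G"
    using assms(3,4) N1 G by (simp_all add: K_def D_def \<theta>_def)
  note result = assignment_value_solve[of G k xs ys K D \<theta>, folded \<phi>_def, unfolded G(2,3), OF G(1,4) _ assms(10) pos(1-3) q codeg deg]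
  show "is_assignment G \<phi>" "encode_assignment G \<phi> = enc (xs, ys)"
    using result(1,2) assms(4) by auto
  have "K * \<theta> * (real m)\<^sup>2 \<le> 2 * D\<^sup>2 * m * assignment_value G \<phi>"
    using result(3) assms(4) by auto
  \<comment> \<open>Both sides contain \<open>p\<^sup>2 * m ^ 3\<close>: the left from
    \<open>K * m\<^sup>2\<close>, the right from \<open>2 * D\<^sup>2 * m\<close>. Cancelling it
    leaves the constant 1 / (4 * 18) = 1/72.\<close>
  then have "(p\<^sup>2 * real m ^ 3) * (\<theta> / 4) \<le> (p\<^sup>2 * real m ^ 3) * (18 * assignment_value G \<phi>)"
    by (simp add: K_def D_def power2_eq_square power3_eq_cube mult_ac)
  then have "\<theta> / 4 \<le> 18 * assignment_value G \<phi>"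
    using assms(3,4) by (subst (asm) mult_le_cancel_left_pos) auto
  then show "assignment_value G \<phi> \<ge> 1 / 72 * real (game_size G) powr (- \<gamma>)"
    by (simp add: \<theta>_def)
qed

theorem theorem2:
  fixes \<gamma> :: real
  assumes "\<gamma> > 0"
  shows "\<exists>alg. polynomial_time_on alg (encode_game ` {G. valid_game G}) \<and>
    (\<exists>C > 0. \<exists>\<epsilon> :: nat \<Rightarrow> real. \<epsilon> \<longlonglongrightarrow> 0 \<and>
      (\<forall>n p. n > 0 \<longrightarrow> even n \<longrightarrow> 10 * sqrt (ln (real n) / real n) \<le> p \<longrightarrow> p \<le> 1 \<longrightarrow>
        measure_pmf.prob (random_bipartite (n div 2) (n div 2) p)
          {E. \<forall>G. valid_game G \<and> left_count G = n div 2 \<and> right_count G = n div 2 \<and>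
                  edges G = E \<and> satisfiable G \<longrightarrow>
                (\<exists>\<phi>. produces alg G \<phi> \<and>
                     assignment_value G \<phi> \<ge> C * real (game_size G) powr (- \<gamma>))}
        \<ge> 1 - \<epsilon> n))"
proof -
  define k where "k = nat \<lceil>1 / \<gamma>\<rceil>"
  have "1 / \<gamma> \<le> k"
    unfolding k_def by linarith
  then have k: "1 \<le> k * \<gamma>"
    using assms by (simp add: field_simps)
  obtain alg P where alg: "\<And>x. \<exists>t. runs alg (enc x) t (enc (solve k x)) \<and> t \<le> poly P (size (enc x))"
    using ptime_imp_program[OF ptime_solve] by blast
  have "polynomial_time_on alg (encode_game ` {G. valid_game G})"
    unfolding polynomial_time_on_def using alg by (intro exI[of _ P]) (auto simp only: encode_game_eq; blast)
  moreover have "1 - 2 / real n \<le> measure_pmf.prob (random_bipartite (n div 2) (n div 2) p)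
      {E. \<forall>G. valid_game G \<and> left_count G = n div 2 \<and> right_count G = n div 2 \<and> edges G = E \<and> satisfiable G \<longrightarrow>
        (\<exists>\<phi>. produces alg G \<phi> \<and> assignment_value G \<phi> \<ge> 1 / 72 * real (game_size G) powr (- \<gamma>))}"
      (is "_ \<le> measure_pmf.prob _ ?good")
    if n: "0 < n" "even n" and p: "10 * sqrt (ln (real n) / real n) \<le> p" "p \<le> 1" for n p
  \<comment> \<open>For \<open>n = 2\<close> the claimed probability \<open>1 - 2 / n\<close> is 0.
    Otherwise each side has at least two vertices.\<close>
  proof (cases "n = 2")
    case False
    then have m: "2 \<le> n div 2"
      using n by (auto elim!: evenE)
    then have "0 < ln (real n) / real n"
      by simp
    then have "0 < 10 * sqrt (ln (real n) / real n)"
      by (simp only: real_sqrt_gt_zero mult_pos_pos zero_less_numeral)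
    then have "0 < p"
      using p(1) by linarith
    \<comment> \<open>The inclusion is deterministic: on a well spread graph every satisfiable game
      is handled, however its projections depend on the graph.\<close>
    have "{E. well_spread (n div 2) p E} \<subseteq> ?good"
    proof safe
      fix G
      assume G: "well_spread (n div 2) p (edges G)" "valid_game G" "left_count G = n div 2"
        "right_count G = n div 2" "satisfiable G"
      obtain xs ys where xy: "solve k (n div 2, n div 2, labels G, game_rows G) = (xs, ys)"
        by (metis surj_pair)
      note \<phi> = solve_on_well_spread[OF assms k \<open>0 < p\<close> m G xy]
      have "\<exists>t. runs alg (encode_game G) t (enc (xs, ys))"
        using alg xy G by (metis encode_game_eq)
      then show "\<exists>\<phi>. produces alg G \<phi> \<and> assignment_value G \<phi> \<ge> 1 / 72 * real (game_size G) powr (- \<gamma>)"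
        unfolding produces_def \<phi>(2)[symmetric] using \<phi>(1,3) by blast
    qed
    then have "measure_pmf.prob (random_bipartite (n div 2) (n div 2) p) {E. well_spread (n div 2) p E} \<le>
        measure_pmf.prob (random_bipartite (n div 2) (n div 2) p) ?good"
      by (intro measure_pmf.finite_measure_mono) auto
    with prob_well_spread[OF n p] show ?thesis
      by linarith
  qed simp
  moreover have "(\<lambda>n. 2 / real n) \<longlonglongrightarrow> 0"
    by (rule lim_const_over_n)
  ultimately show ?thesis
    by (intro exI[of _ alg] conjI exI[of _ "1 / 72 :: real"] exI[of _ "\<lambda>n. 2 / real n"] allI impI) simp_all
qed

end
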